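(* Let $G=C_m\times H$ be a finite abelian group with $m=\exp(G)$, such that for every prime divisor $p$ of $m$ with $p^e \parallel m$ and $e\geq 2$, the Sylow $p$-subgroup of $H$ has exponent less than $p^e$. Let $D$ be a non-trivial difference set in $G$. Define $c_{m}=1$ if $8\nmid m$ and $c_{m}=2$ otherwise. Then at least one of the following holds: (1) $M(D)$ is isomorphic to a subgroup of $(\mathbb{Z}/c_m\operatorname{rad}(m)\mathbb{Z})^\times$, and in particular $|M(D)|\leq c_m \varphi(\operatorname{rad}(m))$; (2) $D$ is a Hadamard difference set, $2^e\parallel m$ with $e\geq 2$, and writing $G=C_{2^e}\times H'$ where the Sylow $2$-subgroup of $H'$ has exponent less than $2^e$, $D$ has a multiplier $t$ with $t\equiv 1+2^{e-1}\pmod{2^e}$ and $t\equiv 1\pmod{\exp(H')}$.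
   Context: $C_k$ is the cyclic group of order $k$. A $(v,k,\lambda)$ difference set in an abelian group $G$ of order $v$ is a $k$-subset $D$ such that every non-identity element can be written as $d_1d_2^{-1}$, $d_1,d_2\in D$, in exactly $\lambda$ ways; its order is $n=k-\lambda$, it is assumed that $k<v/2$, and $D$ is non-trivial if $n>1$. For $t$ coprime to $|G|$, $D^{(t)}=\{d^t:d\in D\}$ and $t$ is a (numerical) multiplier if $D^{(t)}=Dg$ for some $g\in G$; $M(D)$ is the group of multipliers, viewed as a subgroup of $(\mathbb{Z}/m\mathbb{Z})^\times$. A Hadamard difference set has parameters $(4u^2,2u^2-u,u^2-u)$. $\varphi$ is Euler's totient function and $\operatorname{rad}(m)$ is the product of the distinct prime divisors of $m$. *)

theory Defs
  imports "HOL-Algebra.Elementary_Groups" "HOL-Number_Theory.Number_Theory"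
begin

definition group_exponent :: "('a, 'b) monoid_scheme \<Rightarrow> nat" where
  "group_exponent G = (LEAST n. n > 0 \<and> (\<forall>x\<in>carrier G. x [^]\<^bsub>G\<^esub> n = \<one>\<^bsub>G\<^esub>))"

definition sylow_subgroup :: "nat \<Rightarrow> ('a, 'b) monoid_scheme \<Rightarrow> 'a set \<Rightarrow> bool" where
  "sylow_subgroup p G P \<longleftrightarrow> subgroup P G \<and> card P = p ^ multiplicity p (order G)"

definition difference_set ::
    "('a, 'b) monoid_scheme \<Rightarrow> nat \<Rightarrow> nat \<Rightarrow> nat \<Rightarrow> 'a set \<Rightarrow> bool" where
  "difference_set G v k l D \<longleftrightarrow>
     comm_group G \<and> finite (carrier G) \<and> order G = v \<and>
     D \<subseteq> carrier G \<and> card D = k \<and>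
     (\<forall>g\<in>carrier G - {\<one>\<^bsub>G\<^esub>}.
        card {(d1, d2). d1 \<in> D \<and> d2 \<in> D \<and> d1 \<otimes>\<^bsub>G\<^esub> inv\<^bsub>G\<^esub> d2 = g} = l)"

definition hadamard_difference_set :: "('a, 'b) monoid_scheme \<Rightarrow> 'a set \<Rightarrow> bool" where
  "hadamard_difference_set G D \<longleftrightarrow>
     (\<exists>u::nat. difference_set G (4 * u\<^sup>2) (2 * u\<^sup>2 - u) (u\<^sup>2 - u) D)"

definition multiplier :: "('a, 'b) monoid_scheme \<Rightarrow> 'a set \<Rightarrow> int \<Rightarrow> bool" where
  "multiplier G D t \<longleftrightarrow>
     coprime t (int (order G)) \<and>
     (\<exists>g\<in>carrier G. (\<lambda>d. d [^]\<^bsub>G\<^esub> t) ` D = D #>\<^bsub>G\<^esub> g)"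

text \<open>The group \<open>(\<int>/n\<int>)\<^sup>\<times>\<close>. The library's \<^const>\<open>residue_ring\<close> represents
  \<open>\<int>/n\<int>\<close> only for \<open>n > 1\<close>.\<close>

abbreviation unit_group_mod :: "nat \<Rightarrow> int monoid" where
  "unit_group_mod n \<equiv> units_of (residue_ring (int n))"

text \<open>Whether \<open>t\<close> is a multiplier depends only on \<open>t\<close> modulo the exponent of the group,
  so the multiplier group consists of residue classes modulo the exponent.\<close>

definition multiplier_group :: "('a, 'b) monoid_scheme \<Rightarrow> 'a set \<Rightarrow> int monoid" where
  "multiplier_group G D =
     (unit_group_mod (group_exponent G))
       \<lparr>carrier := (\<lambda>t. t mod int (group_exponent G)) ` {t. multiplier G D t}\<rparr>"

definition rad :: "nat \<Rightarrow> nat" where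
  "rad m = \<Prod>(prime_factors m)"

definition c_factor :: "nat \<Rightarrow> nat" where
  "c_factor m = (if 8 dvd m then 2 else 1)"

end

theory Submission
  imports Defs "HOL-Algebra.Sylow"
begin

text \<open>
  If reduction modulo \<open>c\<^sub>m rad(m)\<close> is not injective on \<open>M(D)\<close>, then some multiplier \<open>s\<close> satisfies
  \<open>s \<noteq> 1\<close> and \<open>q (s - 1) = 0\<close> modulo \<open>m\<close> for a prime \<open>q\<close> with \<open>q\<^sup>2\<close> dividing \<open>m\<close>. The hypothesis on
  \<open>H\<close> makes the image of \<open>x \<mapsto> x\<^bsup>s-1\<^esup>\<close> a group \<open>\<langle>z\<rangle>\<close> of order \<open>q\<close>, with kernel \<open>N\<close> of index \<open>q\<close>. Replacing
  \<open>D\<close> by a translate fixed by \<open>s\<close>, both \<open>D - N\<close> and its complement in \<open>G - N\<close> are unions of cosets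
  of \<open>\<langle>z\<rangle>\<close>. Hence \<open>b = |D - N|\<close> is at most \<open>|D \<inter> Dz| = \<lambda>\<close>, and the complement gives
  \<open>b \<ge> 2k - \<lambda> - v/q\<close>. Together with the count of pairs of \<open>D\<close> in a common coset of \<open>N\<close> and
  \<open>k < v/2\<close>, these bounds leave only \<open>q = 2\<close> and the Hadamard parameters.
\<close>

section \<open>Residues modulo the radical\<close>

lemma prime_dvd_rad:
  assumes "Factorial_Ring.prime p" "p dvd m" "m > 0"
  shows "p dvd rad m"
  unfolding rad_def using assms by (intro dvd_prodI) (auto simp: prime_factors_dvd)

text \<open>The binomial expansion of \<open>(1 + (s - 1)) ^ i\<close>, cut off after its linear
  term.\<close>

lemma power_cong_one_plus:
  fixes s :: int
  shows "(s - 1)\<^sup>2 dvd s ^ i - 1 - int i * (s - 1)"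
proof (induction i)
  case (Suc i)
  have "s ^ Suc i - 1 - int (Suc i) * (s - 1) = s * (s ^ i - 1 - int i * (s - 1)) + int i * (s - 1)\<^sup>2"
    by (simp add: algebra_simps power2_eq_square)
  then show ?case using Suc by (simp add: dvd_add)
qed simp

text \<open>Sums the truncated expansions. The second-order precision decides whether
  \<open>q ^ 2\<close> divides the geometric sum of length \<open>q\<close>.\<close>

lemma geometric_sum_cong:
  fixes s :: int
  shows "(s - 1)\<^sup>2 dvd (\<Sum>i<n. s ^ i) - int n - (s - 1) * int (n * (n - 1) div 2)"
proof -
  have "(\<Sum>i<n. s ^ i) - int n - (s - 1) * (\<Sum>i<n. int i) = (\<Sum>i<n. s ^ i - 1 - int i * (s - 1))"
    by (simp add: sum_subtractf sum_distrib_left mult.commute)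
  moreover have "(s - 1)\<^sup>2 dvd (\<Sum>i<n. s ^ i - 1 - int i * (s - 1))"
    by (intro dvd_sum power_cong_one_plus)
  moreover have "(\<Sum>i<n. int i) = int (n * (n - 1) div 2)"
  proof -
    have "(\<Sum>i<n. i) = n * (n - 1) div 2"
      using Sum_Ico_nat[of 0 n] by (simp add: atLeast0LessThan)
    then show ?thesis by (simp flip: of_nat_sum)
  qed
  ultimately show ?thesis by simp
qed

lemma dvd_geometric_sum_minus:
  fixes s :: int
  shows "s - 1 dvd (\<Sum>i<n. s ^ i) - int n"
proof -
  have "(\<Sum>i<n. s ^ i) - int n = (\<Sum>i<n. s ^ i - 1)" by (simp add: sum_subtractf)
  moreover have "s - 1 dvd (\<Sum>i<n. s ^ i - 1)"
    by (intro dvd_sum) (simp add: power_diff_1_eq)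
  ultimately show ?thesis by simp
qed

lemma coprime_int_natI:
  fixes a :: int and m :: nat
  assumes "\<And>p::nat. Factorial_Ring.prime p \<Longrightarrow> int p dvd a \<Longrightarrow> p dvd m \<Longrightarrow> False"
  shows "coprime a (int m)"
proof (rule ccontr)
  assume "\<not> coprime a (int m)"
  then have "gcd (nat \<bar>a\<bar>) m \<noteq> 1"
    by (metis coprime_iff_gcd_eq_1 gcd_int_int_eq gcd_abs1_int int_nat_eq nat_0_le abs_ge_zero of_nat_1)
  then obtain p :: nat where "Factorial_Ring.prime p" "p dvd gcd (nat \<bar>a\<bar>) m"
    using prime_factor_nat by blast
  then have "p dvd nat \<bar>a\<bar>" "p dvd m" by (meson dvd_trans gcd_dvd1 gcd_dvd2)+
  then show False using assms \<open>Factorial_Ring.prime p\<close> dvd_nat_abs_iff by blast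
qed

text \<open>Factor \<open>s ^ q - 1 = (s - 1) * S\<close> with \<open>S\<close> the geometric sum.
  Modulo each prime divisor of \<open>m\<close>, \<open>s\<close> is 1 and \<open>S\<close> is
  \<open>q\<close>, so \<open>S\<close> shares no prime with \<open>m\<close> except possibly
  \<open>q\<close>. Unless \<open>q = 2\<close> and 8 does not divide \<open>m\<close>, the prime
  \<open>q\<close> occurs in \<open>S\<close> only once, so cancelling \<open>S\<close> from
  \<open>m dvd (s - 1) * S\<close> costs one factor \<open>q\<close>.\<close>

lemma prime_order_kernel_element:
  fixes s :: int and m q :: nat
  assumes m: "m > 0" and q: "Factorial_Ring.prime q"
    and s: "int (c_factor m * rad m) dvd s - 1"
    and sq: "int m dvd s ^ q - 1" and s1: "\<not> int m dvd s - 1"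
  shows "q\<^sup>2 dvd m \<and> int m dvd int q * (s - 1)"
proof -
  define S where "S = (\<Sum>i<q. s ^ i)"
  have mS: "int m dvd (s - 1) * S" using sq by (simp add: S_def power_diff_1_eq)
  have rad: "int p dvd s - 1" if "Factorial_Ring.prime p" "p dvd m" for p :: nat
  proof -
    have "p dvd c_factor m * rad m" using prime_dvd_rad[OF that m] by simp
    then show ?thesis using s by (meson dvd_trans int_dvd_int_iff)
  qed
  have pS: "p = q" if p: "Factorial_Ring.prime p" "p dvd m" "int p dvd S" for p :: nat
  proof -
    have "int p dvd S - int q"
      using rad[OF p(1,2)] dvd_geometric_sum_minus[of s q] unfolding S_def by (rule dvd_trans)
    then have "int p dvd int q" using p(3) by (metis dvd_diff_right_iff)
    then show ?thesis using p(1) q primes_dvd_imp_eq int_dvd_int_iff by blast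
  qed
  \<comment> \<open>Otherwise \<open>S\<close> would be coprime to \<open>m\<close> and could be
    cancelled entirely.\<close>
  have qm: "q dvd m"
  proof (rule ccontr)
    assume "\<not> q dvd m"
    then have "coprime S (int m)" using pS by (intro coprime_int_natI) blast
    then show False using mS s1 by (simp add: coprime_commute coprime_dvd_mult_left_iff)
  qed
  have qs: "int q dvd s - 1" using rad q qm by blast
  have qS: "int q dvd S"
  proof -
    have "int q dvd S - int q"
      using qs dvd_geometric_sum_minus[of s q] unfolding S_def by (rule dvd_trans)
    then show ?thesis by (metis dvd_diff_left_iff dvd_refl)
  qed
  have main: "int m dvd int q * (s - 1)"
  \<comment> \<open>In the exceptional case 4 may divide \<open>S = 1 + s\<close>, but the 2-part of
    \<open>m\<close> is at most 4 and divides \<open>2 * (s - 1)\<close> because \<open>s\<close> is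
    odd. The odd part of \<open>m\<close> is coprime to \<open>S\<close>.\<close>
  proof (cases "q = 2 \<and> \<not> 8 dvd m")
    case True
    define f where "f = multiplicity 2 m"
    obtain r where r: "m = 2 ^ f * r" "\<not> 2 dvd r"
      using multiplicity_decompose'[of m 2] m f_def by auto
    have "f \<le> 2"
    proof (rule ccontr)
      assume "\<not> f \<le> 2"
      then have "(2::nat) ^ 3 dvd 2 ^ f" by (intro le_imp_power_dvd) simp
      then show False using True r(1) by simp
    qed
    then have "(2::int) ^ f dvd 2 ^ 2" by (intro le_imp_power_dvd)
    moreover have "2 ^ 2 dvd 2 * (s - 1)"
      unfolding power2_eq_square by (intro mult_dvd_mono) (use qs True in auto)
    ultimately have f: "2 ^ f dvd 2 * (s - 1)" by (rule dvd_trans)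
    have "coprime S (int r)"
      using pS r True by (intro coprime_int_natI) (metis dvd_mult)
    moreover have "int r dvd (s - 1) * S" using mS r(1) by (metis dvd_mult_right of_nat_mult)
    ultimately have "int r dvd s - 1" by (simp add: coprime_commute coprime_dvd_mult_left_iff)
    then have "int r dvd 2 * (s - 1)" by (rule dvd_mult)
    moreover have "coprime (2 ^ f) (int r)" using r(2) by simp
    ultimately have "2 ^ f * int r dvd 2 * (s - 1)" using divides_mult[OF f] by blast
    then show ?thesis using True r(1) by simp
  next
    case False
    obtain u where u: "S = int q * u" using qS by blast
    \<comment> \<open>Modulo \<open>q ^ 2\<close>, \<open>S\<close> is
      \<open>q + (s - 1) * (q * (q - 1) div 2)\<close>, and the second term vanishes: for odd
      \<open>q\<close> both of its factors are multiples of \<open>q\<close>, while for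
      \<open>q = 2\<close> the value \<open>c_factor m = 2\<close> forces 4 to divide
      \<open>s - 1\<close>.\<close>
    have nq2: "\<not> int q ^ 2 dvd S"
    proof
      assume d: "int q ^ 2 dvd S"
      have d4: "int q ^ 2 dvd (s - 1) * int (q * (q - 1) div 2)"
      proof (cases "q = 2")
        case True
        then have "8 dvd m" using False by simp
        then have "c_factor m = 2" by (simp add: c_factor_def)
        moreover have "2 dvd rad m" using prime_dvd_rad[of 2 m] m qm True by simp
        ultimately have "4 dvd c_factor m * rad m" by auto
        then have "int 4 dvd s - 1" using s by (meson dvd_trans int_dvd_int_iff)
        then show ?thesis using True by simp
      next
        case False
        then have "odd q" using q primes_dvd_imp_eq two_is_prime_nat by blast
        then have "q * (q - 1) div 2 = q * ((q - 1) div 2)" by (simp add: div_mult_swap)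
        then have "int q dvd int (q * (q - 1) div 2)" by simp
        then show ?thesis unfolding power2_eq_square by (rule mult_dvd_mono[OF qs])
      qed
      have "int q ^ 2 dvd S - int q - (s - 1) * int (q * (q - 1) div 2)"
        using geometric_sum_cong[of s q] qs unfolding S_def by (meson dvd_power_same dvd_trans)
      then have "int q ^ 2 dvd int q" using d d4 by (metis dvd_diff_left_iff dvd_diff_right_iff)
      then have "q ^ 2 dvd q" by (metis int_dvd_int_iff of_nat_power)
      then show False using prime_gt_1_nat[OF q] by (auto simp: power2_eq_square dest!: dvd_imp_le)
    qed
    have "coprime u (int m)"
    proof (rule coprime_int_natI)
      fix p :: nat assume p: "Factorial_Ring.prime p" "int p dvd u" "p dvd m"
      then have "p = q" using pS u by simp
      then show False using p(2) u nq2 by (simp add: power2_eq_square mult_dvd_mono)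
    qed
    moreover have "int m dvd (int q * (s - 1)) * u" using mS u by (simp add: mult_ac)
    ultimately show ?thesis by (simp add: coprime_commute coprime_dvd_mult_left_iff)
  qed
  \<comment> \<open>By \<open>main\<close>, \<open>m1 = m div q\<close> divides
    \<open>s - 1\<close>. If \<open>q\<close> did not divide \<open>m1\<close>, then
    \<open>q dvd s - 1\<close> would improve this to \<open>m dvd s - 1\<close>.\<close>
  obtain m1 where m1: "m = q * m1" using qm by blast
  have q0: "q > 0" using q prime_gt_0_nat by blast
  obtain w where "int q * (s - 1) = int m * w" using main by blast
  then have w: "s - 1 = int m1 * w" using m1 q0 by simp
  have "q dvd m1"
  proof (rule ccontr)
    assume "\<not> q dvd m1"
    then have "int q dvd w" using qs w q
      by (metis int_dvd_int_iff prime_dvd_mult_iff prime_nat_int_transfer)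
    then have "int m dvd s - 1" using w m1 by (simp add: mult.commute mult_dvd_mono)
    then show False using s1 by simp
  qed
  then show ?thesis using main m1 by (simp add: power2_eq_square)
qed

text \<open>Let \<open>i\<close> be the order of \<open>t\<close> modulo \<open>m\<close>,
  \<open>q\<close> a prime divisor of \<open>i\<close> and \<open>j = i div q\<close>. Then
  \<open>t ^ j\<close> has order \<open>q\<close> modulo \<open>m\<close> and is still 1 modulo
  \<open>c_factor m * rad m\<close>.\<close>

lemma exists_power_of_prime_order:
  fixes t :: int and m :: nat
  assumes m: "m > 0" and "coprime t (int m)"
    and t: "int (c_factor m * rad m) dvd t - 1" and t1: "\<not> int m dvd t - 1"
  shows "\<exists>q j. Factorial_Ring.prime q \<and> q\<^sup>2 dvd m \<and> int m dvd int q * (t ^ j - 1) \<and> \<not> int m dvd t ^ j - 1"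
proof -
  have m1: "int m > 1" using m t1 by (cases "m = 1") auto
  let ?P = "\<lambda>j. j > 0 \<and> int m dvd t ^ j - 1"
  have "[t ^ totient m = 1] (mod int m)"
    using residues.euler_theorem[of "int m" t] m1 assms by (simp add: residues_def)
  then have "?P (totient m)" using m by (simp add: cong_iff_dvd_diff)
  then have P: "?P (LEAST j. ?P j)" by (rule LeastI)
  define i where "i = (LEAST j. ?P j)"
  have i: "?P i" using P by (simp add: i_def)
  have min: "\<not> ?P j" if "j < i" for j using that not_less_Least unfolding i_def by blast
  have "i \<noteq> 1" using i t1 by auto
  then obtain q where q: "Factorial_Ring.prime q" "q dvd i" using prime_factor_nat by blast
  then obtain j where j: "i = q * j" by blast
  have jpos: "j > 0" using j i by (cases j) auto
  then have "j < i" using j prime_gt_1_nat[OF q(1)] by simp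
  then have nj: "\<not> int m dvd t ^ j - 1" using min jpos by blast
  have "t - 1 dvd t ^ j - 1" by (simp add: power_diff_1_eq)
  then have "int (c_factor m * rad m) dvd t ^ j - 1" using t by (rule dvd_trans[rotated])
  moreover have "int m dvd (t ^ j) ^ q - 1" using i j by (simp add: power_mult[symmetric] mult.commute)
  ultimately show ?thesis using prime_order_kernel_element[OF m q(1)] nj q(1) by blast
qed

lemma rad_dvd:
  assumes "m > 0"
  shows "rad m dvd m"
proof -
  have "(\<Prod>p\<in>prime_factors m. p) dvd (\<Prod>p\<in>prime_factors m. p ^ multiplicity p m)"
  proof (rule prod_dvd_prod)
    fix p assume "p \<in> prime_factors m"
    then have "multiplicity p m > 0" by (simp add: prime_factors_multiplicity)
    then show "p dvd p ^ multiplicity p m" by (intro dvd_power) auto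
  qed
  then show ?thesis using assms by (simp add: rad_def prod_prime_factors)
qed

text \<open>If \<open>8 dvd m\<close>, halving \<open>m\<close> keeps all its prime divisors, so
  \<open>rad m\<close> already divides \<open>m div 2\<close>.\<close>

lemma c_factor_rad_dvd:
  assumes m: "m > 0"
  shows "c_factor m * rad m dvd m"
proof (cases "8 dvd m")
  case True
  then obtain n where n: "m = 2 * n" "2 dvd n" by (auto elim!: dvdE)
  then have "p dvd m \<longleftrightarrow> p dvd n" if "Factorial_Ring.prime p" for p
    using that by (metis dvd_mult dvd_trans prime_dvd_mult_iff primes_dvd_imp_eq two_is_prime_nat)
  then have "prime_factors m = prime_factors n"
    using m n by (auto simp: prime_factors_dvd)
  then have "rad m dvd n" using rad_dvd[of n] m n by (simp add: rad_def)
  then show ?thesis using n True by (simp add: c_factor_def)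
qed (use rad_dvd[OF m] in \<open>simp add: c_factor_def\<close>)

text \<open>If \<open>8 dvd m\<close>, then \<open>rad m\<close> is even, so doubling it doubles its
  totient.\<close>

lemma totient_c_factor_rad:
  assumes "m > 0"
  shows "totient (c_factor m * rad m) = c_factor m * totient (rad m)"
proof (cases "8 dvd m")
  case True
  then have "2 dvd m" using dvd_trans[of 2 8 m] by simp
  then have "2 dvd rad m" using prime_dvd_rad[of 2 m] assms by simp
  then show ?thesis using True by (simp add: c_factor_def totient_double)
qed (simp add: c_factor_def)

lemma rad_gt_one:
  assumes "m > 1"
  shows "rad m > 1"
proof -
  obtain p where p: "Factorial_Ring.prime p" "p dvd m" using prime_factor_nat[of m] assms by auto
  then have "p dvd rad m" using prime_dvd_rad assms by simp
  moreover have "rad m > 0" using rad_dvd[of m] assms by (auto intro!: Nat.gr0I)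
  ultimately show ?thesis using prime_gt_1_nat[OF p(1)] by (auto dest: dvd_imp_le)
qed

text \<open>With \<open>m = 2 ^ e * r\<close>, \<open>r\<close> odd, the equation
  \<open>2 * (s - 1) = m * w\<close> gives \<open>s - 1 = 2 ^ (e - 1) * (r * w)\<close>. An even
  \<open>w\<close> would give \<open>m dvd s - 1\<close>, so \<open>r * w\<close> is odd.\<close>

lemma cong_one_plus_half_power:
  fixes s :: int and m :: nat
  assumes m: "m > 0" "2 dvd m" and s: "int m dvd 2 * (s - 1)" "\<not> int m dvd s - 1"
  shows "[s = 1 + 2 ^ (multiplicity 2 m - 1)] (mod 2 ^ multiplicity 2 m)"
proof -
  define e where "e = multiplicity 2 m"
  obtain r where r: "m = 2 ^ e * r" "odd r"
    using multiplicity_decompose'[of m 2] m unfolding e_def by auto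
  have "e \<noteq> 0" using m r by (cases "e = 0") auto
  then obtain f where f: "e = Suc f" by (cases e) auto
  obtain w where "2 * (s - 1) = int m * w" using s(1) by blast
  then have w: "s - 1 = 2 ^ f * (int r * w)" using r(1) f by simp
  have "odd w"
  proof
    assume "even w"
    then obtain w' where "w = 2 * w'" by blast
    then have "s - 1 = int m * w'" using w r(1) f by simp
    then show False using s(2) by simp
  qed
  then have "2 dvd int r * w - 1" using r(2) by simp
  then have "2 ^ f * 2 dvd 2 ^ f * (int r * w - 1)" by (rule mult_dvd_mono[OF dvd_refl])
  moreover have "2 ^ f * (int r * w - 1) = s - (1 + 2 ^ f)" using w by (simp add: algebra_simps)
  ultimately have "2 ^ f * 2 dvd s - (1 + 2 ^ f)" by metis
  then have "2 ^ e dvd s - (1 + 2 ^ (e - 1))" using f by (simp add: mult.commute)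
  then show ?thesis unfolding e_def cong_iff_dvd_diff .
qed

section \<open>Exponents and splittings of finite abelian groups\<close>

lemma (in group)
  assumes "finite (carrier G)"
  shows group_exponent_pos: "0 < group_exponent G"
    and pow_group_exponent: "x \<in> carrier G \<Longrightarrow> x [^] group_exponent G = \<one>"
proof -
  have "order G > 0 \<and> (\<forall>x\<in>carrier G. x [^] order G = \<one>)"
    using assms by (simp add: order_gt_0_iff_finite pow_order_eq_1)
  then have "group_exponent G > 0 \<and> (\<forall>x\<in>carrier G. x [^] group_exponent G = \<one>)"
    unfolding group_exponent_def by (rule LeastI)
  then show "0 < group_exponent G" "x \<in> carrier G \<Longrightarrow> x [^] group_exponent G = \<one>" by auto
qed

lemma (in group) group_exponent_dvd:
  assumes fin: "finite (carrier G)" and n: "\<And>x. x \<in> carrier G \<Longrightarrow> x [^] (n::nat) = \<one>"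
  shows "group_exponent G dvd n"
proof -
  let ?E = "group_exponent G"
  \<comment> \<open>The remainder annihilates the group too; being smaller than the least positive
    such exponent, it must be 0.\<close>
  have "x [^] (n mod ?E) = \<one>" if x: "x \<in> carrier G" for x
  proof -
    have "ord x dvd ?E" using pow_group_exponent[OF fin x] x pow_eq_id by blast
    moreover have "ord x dvd n" using n[OF x] x pow_eq_id by blast
    ultimately have "ord x dvd n mod ?E" by (simp add: dvd_mod)
    then show ?thesis using x pow_eq_id by blast
  qed
  moreover have "n mod ?E < ?E" using group_exponent_pos[OF fin] by simp
  ultimately have "n mod ?E = 0"
    using not_less_Least[of "n mod ?E" "\<lambda>n. n > 0 \<and> (\<forall>x\<in>carrier G. x [^] n = \<one>)"]
    unfolding group_exponent_def[symmetric] by auto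
  then show ?thesis by auto
qed

text \<open>The quotient by \<open>P\<close> has order prime to \<open>q\<close>, so elements of
  \<open>q\<close>-power order become trivial in it.\<close>

lemma (in comm_group) mem_sylow_subgroup:
  assumes fin: "finite (carrier G)" and q: "Factorial_Ring.prime q" and P: "sylow_subgroup q G P"
    and y: "y \<in> carrier G" "y [^] (q ^ i) = \<one>"
  shows "y \<in> P"
proof -
  have sub: "subgroup P G" and card: "card P = q ^ multiplicity q (order G)"
    using P by (auto simp: sylow_subgroup_def)
  interpret normal P G using sub by (rule subgroup_imp_normal)
  have ord0: "order G \<noteq> 0" using fin by (simp add: order_gt_0_iff_finite)
  obtain r where r: "order G = q ^ multiplicity q (order G) * r" "\<not> q dvd r"
    using multiplicity_decompose'[of "order G" q] ord0 q by (metis not_prime_unit)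
  have "card (rcosets P) * card P = r * card P"
    using lagrange[OF sub] r(1) card by (simp add: mult.commute)
  moreover have "card P \<noteq> 0" using card q by (simp add: prime_gt_0_nat)
  ultimately have rc: "order (G Mod P) = r" by (simp add: order_def FactGroup_def)
  have "P #> y \<in> carrier (G Mod P)" using y by (auto simp: FactGroup_def RCOSETS_def)
  then have "(P #> y) [^]\<^bsub>G Mod P\<^esub> r = \<one>\<^bsub>G Mod P\<^esub>"
    using group.pow_order_eq_1[OF factorgroup_is_group] rc by blast
  then have "P #> (y [^] r) = P" unfolding FactGroup_pow[OF y(1)] by (simp add: FactGroup_def)
  then have yr: "y [^] r \<in> P" using y by (metis nat_pow_closed rcos_self sub)
  have "coprime r (q ^ i)"
    using r(2) q by (metis coprime_commute coprime_power_right_iff prime_imp_coprime)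
  \<comment> \<open>Since \<open>a\<close> inverts \<open>r\<close> modulo the order of
    \<open>y\<close>, \<open>y\<close> is a power of \<open>y [^] r\<close>, which lies in
    \<open>P\<close>.\<close>
  then obtain a where a: "[r * a = 1] (mod q ^ i)"
    using cong_solve_coprime_nat by (metis One_nat_def)
  have "ord y dvd q ^ i" using y pow_eq_id by blast
  then have "[r * a = 1] (mod ord y)" using a by (rule cong_dvd_modulus_nat[rotated])
  then have "int (ord y) dvd 1 - int (r * a)"
    by (metis cong_iff_dvd_diff cong_int_iff cong_sym of_nat_1)
  then have "y [^] (int (r * a)) = y [^] (1::int)" using int_pow_eq[OF y(1)] by blast
  then have "y [^] (r * a) = y" using y by (metis int_pow_1 int_pow_int)
  then have "y = (y [^] r) [^] a" using y by (simp add: nat_pow_pow)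
  moreover have "(y [^] r) [^] a \<in> P"
    using yr by (induction a) (auto intro: one_closed m_closed)
  ultimately show ?thesis by simp
qed

text \<open>Turns the Sylow hypothesis into the form used later. With \<open>m = q ^ e * r\<close>,
  the element \<open>x [^] r\<close> lies in a Sylow subgroup, and its order, a power of
  \<open>q\<close> below \<open>q ^ e\<close>, divides \<open>q ^ (e - 1)\<close>.\<close>

lemma (in comm_group) pow_div_prime_eq_one:
  assumes fin: "finite (carrier G)" and q: "Factorial_Ring.prime q" and m: "m > 0" "q dvd m"
    and pow: "\<And>x. x \<in> carrier G \<Longrightarrow> x [^] m = \<one>"
    and exp: "\<And>P. sylow_subgroup q G P \<Longrightarrow>
      group_exponent (G\<lparr>carrier := P\<rparr>) < q ^ multiplicity q m"
    and x: "x \<in> carrier G"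
  shows "x [^] (m div q) = \<one>"
proof -
  define e where "e = multiplicity q m"
  have q1: "q > 1" using q by (rule prime_gt_1_nat)
  have e: "e > 0" unfolding e_def using m q by (metis not_prime_unit multiplicity_gt_zero_iff less_numeral_extra(3))
  obtain r where r: "m = q ^ e * r"
    using multiplicity_decompose'[of m q] m q unfolding e_def by (metis not_prime_unit less_numeral_extra(3))
  have ord0: "order G \<noteq> 0" using fin by (simp add: order_gt_0_iff_finite)
  obtain r' where r': "order G = q ^ multiplicity q (order G) * r'"
    using multiplicity_decompose'[of "order G" q] ord0 q by (metis not_prime_unit)
  obtain P where P: "sylow_subgroup q G P"
    using sylow_thm[OF q group_axioms r' fin] by (auto simp: sylow_subgroup_def)
  then have sub: "subgroup P G" by (simp add: sylow_subgroup_def)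
  let ?P = "G\<lparr>carrier := P\<rparr>"
  interpret PG: group ?P using sub group_axioms by (rule subgroup.subgroup_is_group)
  have finP: "finite (carrier ?P)" using sub fin subgroup.subset finite_subset by fastforce
  define y where "y = x [^] r"
  have y: "y \<in> carrier G" using x by (simp add: y_def)
  have yq: "y [^] (q ^ e) = \<one>"
    using pow[OF x] x by (simp add: y_def nat_pow_pow r mult.commute)
  then have "y \<in> P" using mem_sylow_subgroup[OF fin q P y] by blast
  then have "y [^]\<^bsub>?P\<^esub> group_exponent ?P = \<one>\<^bsub>?P\<^esub>"
    using PG.pow_group_exponent[OF finP] by simp
  then have "y [^] group_exponent ?P = \<one>" by (simp add: nat_pow_consistent[symmetric])
  then have "ord y dvd group_exponent ?P" using y pow_eq_id by blast
  then have "ord y \<le> group_exponent ?P" using PG.group_exponent_pos[OF finP] by (rule dvd_imp_le)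
  then have lt: "ord y < q ^ e" using exp[OF P] by (simp add: e_def)
  have "ord y dvd q ^ e" using y yq pow_eq_id by blast
  then obtain j where j: "ord y = q ^ j" using q divides_primepow_nat by blast
  then have "j < e" using lt q1 by simp
  then have "ord y dvd q ^ (e - 1)" unfolding j by (intro le_imp_power_dvd) simp
  then have "y [^] (q ^ (e - 1)) = \<one>" using y pow_eq_id by blast
  moreover have "m div q = r * q ^ (e - 1)"
    using e q1 unfolding r by (cases e) auto
  ultimately show ?thesis using x by (simp add: y_def nat_pow_pow)
qed

section \<open>Coordinates on a group split into a cyclic factor and \<open>H\<close>\<close>

locale cyclic_splitting = comm_group G + H: comm_group H
  for G :: "'a monoid" (structure) and H :: "'b monoid" +
  fixes \<phi> :: "'a \<Rightarrow> int \<times> 'b" and m :: nat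
  assumes finite_G: "finite (carrier G)" and m_pos: "m > 0"
    and \<phi>: "\<phi> \<in> iso G (integer_mod_group m \<times>\<times> H)"
begin

lemma fst_hom: "(\<lambda>x. fst (\<phi> x)) \<in> hom G (integer_mod_group m)"
  using \<phi> unfolding iso_def hom_def by (auto simp: DirProd_def Pi_iff mem_Times_iff case_prod_unfold)

lemma snd_hom: "(\<lambda>x. snd (\<phi> x)) \<in> hom G H"
  using \<phi> unfolding iso_def hom_def by (auto simp: DirProd_def Pi_iff mem_Times_iff case_prod_unfold)

lemma splitting_eqI:
  assumes "x \<in> carrier G" "y \<in> carrier G" "fst (\<phi> x) = fst (\<phi> y)" "snd (\<phi> x) = snd (\<phi> y)"
  shows "x = y"
proof -
  have "inj_on \<phi> (carrier G)" using \<phi> by (simp add: iso_def bij_betw_def)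
  then show ?thesis using assms by (simp add: inj_on_def prod_eq_iff)
qed

lemma splitting_surj:
  assumes "0 \<le> i" "i < int m" "h \<in> carrier H"
  obtains x where "x \<in> carrier G" "fst (\<phi> x) = i" "snd (\<phi> x) = h"
proof -
  have "(i, h) \<in> \<phi> ` carrier G"
    using \<phi> assms unfolding iso_def bij_betw_def by (auto simp: carrier_integer_mod_group)
  then show thesis using that by (metis imageE fst_conv snd_conv)
qed

lemma fst_range: "x \<in> carrier G \<Longrightarrow> 0 \<le> fst (\<phi> x) \<and> fst (\<phi> x) < int m"
  using fst_hom m_pos by (auto simp: hom_def Pi_iff carrier_integer_mod_group)

lemma fst_mult: "x \<in> carrier G \<Longrightarrow> y \<in> carrier G \<Longrightarrow> fst (\<phi> (x \<otimes> y)) = (fst (\<phi> x) + fst (\<phi> y)) mod int m"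
  using fst_hom by (auto simp: hom_def)

lemma snd_closed: "x \<in> carrier G \<Longrightarrow> snd (\<phi> x) \<in> carrier H"
  using snd_hom by (auto simp: hom_def)

lemma fst_pow: "x \<in> carrier G \<Longrightarrow> fst (\<phi> (x [^] (n::int))) = n * fst (\<phi> x) mod int m"
  using hom_int_pow[OF fst_hom _ is_group group_integer_mod_group]
  by (simp add: int_pow_integer_mod_group)

lemma snd_pow: "x \<in> carrier G \<Longrightarrow> snd (\<phi> (x [^] (n::int))) = snd (\<phi> x) [^]\<^bsub>H\<^esub> n"
  using hom_int_pow[OF snd_hom _ is_group H.is_group] by simp

lemma fst_one: "fst (\<phi> \<one>) = 0"
  using hom_one[OF fst_hom is_group group_integer_mod_group] by simp

lemma snd_one: "snd (\<phi> \<one>) = \<one>\<^bsub>H\<^esub>"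
  using hom_one[OF snd_hom is_group H.is_group] by simp

lemma finite_H: "finite (carrier H)"
proof -
  have "carrier H \<subseteq> (\<lambda>x. snd (\<phi> x)) ` carrier G"
  proof
    fix h assume "h \<in> carrier H"
    then obtain x where "x \<in> carrier G" "snd (\<phi> x) = h"
      using splitting_surj[of 0 h] m_pos by auto
    then show "h \<in> (\<lambda>x. snd (\<phi> x)) ` carrier G" by blast
  qed
  then show ?thesis using finite_G finite_subset by blast
qed

lemma H_pow_eq_one:
  assumes "\<And>x. x \<in> carrier G \<Longrightarrow> x [^] (n::nat) = \<one>" "h \<in> carrier H"
  shows "h [^]\<^bsub>H\<^esub> n = \<one>\<^bsub>H\<^esub>"
proof -
  obtain x where x: "x \<in> carrier G" "snd (\<phi> x) = h"
    using splitting_surj[of 0 h] m_pos assms(2) by auto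
  have "h [^]\<^bsub>H\<^esub> n = snd (\<phi> (x [^] n))"
    using snd_pow[OF x(1), of "int n"] x(2) by (simp add: int_pow_int)
  then show ?thesis using assms(1)[OF x(1)] snd_one by simp
qed

lemma H_int_pow_eq_one:
  assumes "h \<in> carrier H" "h [^]\<^bsub>H\<^esub> (n::nat) = \<one>\<^bsub>H\<^esub>" "int n dvd i"
  shows "h [^]\<^bsub>H\<^esub> i = \<one>\<^bsub>H\<^esub>"
proof -
  obtain j where "i = int n * j" using assms(3) by blast
  then show ?thesis using assms by (simp add: H.int_pow_pow[symmetric] int_pow_int)
qed

text \<open>In coordinates \<open>x = (i, h)\<close>, the power \<open>x [^] (s - 1)\<close> is
  \<open>(i * (s - 1), 1)\<close>, since \<open>m div q\<close> divides \<open>s - 1\<close> and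
  annihilates \<open>H\<close>. So the image is generated by \<open>z = (s - 1, 1)\<close>, of order
  \<open>q\<close> because \<open>q * (s - 1)\<close>, but not \<open>s - 1\<close>, vanishes modulo
  \<open>m\<close>.\<close>

lemma cyclic_power_range:
  fixes s :: int
  assumes q: "Factorial_Ring.prime q" "q\<^sup>2 dvd m" and s: "int m dvd int q * (s - 1)" "\<not> int m dvd s - 1"
    and H: "\<And>h. h \<in> carrier H \<Longrightarrow> h [^]\<^bsub>H\<^esub> (m div q) = \<one>\<^bsub>H\<^esub>"
  shows "\<exists>z\<in>carrier G. ord z = q \<and> z [^] (s - 1) = \<one> \<and> (\<exists>x\<in>carrier G. x [^] (s - 1) = z) \<and>
    (\<forall>x\<in>carrier G. \<exists>i::nat. x [^] (s - 1) = z [^] i)"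
proof -
  have q1: "q > 1" using q(1) by (rule prime_gt_1_nat)
  obtain m1 where "m = q\<^sup>2 * m1" using q(2) by blast
  then have m1: "m = q * (q * m1)" by (simp add: power2_eq_square)
  have mq: "m div q = q * m1" using m1 q1 by simp
  have d: "int (m div q) dvd s - 1"
    using s(1) m1 q1 unfolding mq by simp
  \<comment> \<open>Here \<open>q ^ 2 dvd m\<close> makes \<open>q\<close> a divisor of
    \<open>m div q\<close>. Consequently \<open>m\<close> divides \<open>(s - 1) ^ 2\<close>, which
    puts \<open>z\<close> into the kernel below.\<close>
  then have qs: "int q dvd s - 1" unfolding mq by (metis dvd_mult_left of_nat_mult)
  have "int m > 1" using s(2) m_pos by (cases "m = 1") auto
  then obtain g where g: "g \<in> carrier G" "fst (\<phi> g) = 1" "snd (\<phi> g) = \<one>\<^bsub>H\<^esub>"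
    using splitting_surj[of 1 "\<one>\<^bsub>H\<^esub>"] by auto
  define z where "z = g [^] (s - 1)"
  have z: "z \<in> carrier G" "fst (\<phi> z) = (s - 1) mod int m" "snd (\<phi> z) = \<one>\<^bsub>H\<^esub>"
    using g by (auto simp: z_def fst_pow snd_pow)
  have z_pow: "fst (\<phi> (z [^] i)) = i * (s - 1) mod int m" "snd (\<phi> (z [^] i)) = \<one>\<^bsub>H\<^esub>" for i :: int
    using z by (auto simp: fst_pow snd_pow mod_mult_right_eq)
  have zq: "z [^] (int q) = \<one>"
    by (rule splitting_eqI) (use z z_pow s(1) fst_one snd_one in auto)
  have "z \<noteq> \<one>" using z(2) fst_one s(2) by (auto simp: dvd_eq_mod_eq_0)
  then have "ord z \<noteq> 1" using z(1) ord_eq_1 by blast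
  moreover have "ord z dvd q" using zq z(1) by (simp add: int_pow_int pow_eq_id)
  ultimately have "ord z = q" using q(1) by (auto simp: prime_nat_iff)
  moreover have "z [^] (s - 1) = \<one>"
  proof (rule splitting_eqI)
    have "int m dvd (s - 1) * (s - 1)"
      using s(1) qs by (meson dvd_trans mult_dvd_mono dvd_refl)
    then show "fst (\<phi> (z [^] (s - 1))) = fst (\<phi> \<one>)" using z_pow fst_one by simp
  qed (use z z_pow snd_one in auto)
  moreover have "\<exists>i::nat. x [^] (s - 1) = z [^] i" if x: "x \<in> carrier G" for x
  proof -
    have "x [^] (s - 1) = z [^] (fst (\<phi> x))"
    proof (rule splitting_eqI)
      show "snd (\<phi> (x [^] (s - 1))) = snd (\<phi> (z [^] fst (\<phi> x)))"
        using H_int_pow_eq_one[OF _ H d] snd_closed x by (simp add: snd_pow z_pow)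
    qed (use x z z_pow in \<open>auto simp: fst_pow mult.commute\<close>)
    also have "\<dots> = z [^] (nat (fst (\<phi> x)))" using fst_range[OF x] by (simp flip: int_pow_int)
    finally show ?thesis by blast
  qed
  ultimately show ?thesis using z(1) g(1) z_def by blast
qed

text \<open>The complement consists of the elements whose first coordinate is divisible by
  \<open>p ^ e\<close>; as a subgroup of \<open>G\<close> it has its carrier in type
  \<open>'a\<close>. It is annihilated by \<open>m div p\<close>, so its elements of
  \<open>p\<close>-power order have order dividing \<open>p ^ (e - 1)\<close>.\<close>

lemma exists_primary_splitting:
  assumes p: "Factorial_Ring.prime p" "p dvd m"
    and H: "\<And>h. h \<in> carrier H \<Longrightarrow> h [^]\<^bsub>H\<^esub> (m div p) = \<one>\<^bsub>H\<^esub>"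
  defines "e \<equiv> multiplicity p m"
  shows "\<exists>H' :: 'a monoid. comm_group H' \<and> G \<cong> integer_mod_group (p ^ e) \<times>\<times> H' \<and>
    (\<forall>P. sylow_subgroup p H' P \<longrightarrow> group_exponent (H'\<lparr>carrier := P\<rparr>) < p ^ e)"
proof -
  have p1: "p > 1" using p(1) by (rule prime_gt_1_nat)
  have e0: "e > 0" unfolding e_def using m_pos p by (metis not_prime_unit multiplicity_gt_zero_iff less_numeral_extra(3))
  obtain r where r: "m = p ^ e * r" "\<not> p dvd r"
    using multiplicity_decompose'[of m p] m_pos p unfolding e_def by (metis not_prime_unit less_numeral_extra(3))
  define N where "N = p ^ e"
  have mN: "m = N * r" using r(1) by (simp add: N_def)
  have pem: "int (N) dvd int m" using mN by simp
  define K where "K = {x \<in> carrier G. int (N) dvd fst (\<phi> x)}"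
  have dvd_mult: "int (N) dvd fst (\<phi> (x \<otimes> y)) \<longleftrightarrow> int (N) dvd fst (\<phi> x) + fst (\<phi> y)"
    if "x \<in> carrier G" "y \<in> carrier G" for x y
    using that pem by (simp add: fst_mult dvd_mod_iff)
  have dvd_pow: "int (N) dvd fst (\<phi> (x [^] i)) \<longleftrightarrow> int (N) dvd i * fst (\<phi> x)"
    if "x \<in> carrier G" for x and i :: int
    using that pem by (simp add: fst_pow dvd_mod_iff)
  have sub: "subgroup K G"
  proof (rule subgroupI)
    show "K \<noteq> {}" using fst_one by (auto simp: K_def)
    fix a assume a: "a \<in> K"
    then have "int (N) dvd fst (\<phi> (a [^] (-1::int)))" by (subst dvd_pow) (auto simp: K_def)
    then show "inv a \<in> K" using a by (simp add: K_def int_pow_neg)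
  qed (auto simp: K_def dvd_mult)
  define H' where "H' = G\<lparr>carrier := K\<rparr>"
  have comm: "comm_group H'"
    unfolding H'_def
    by (rule group.group_comm_groupI[OF subgroup_imp_group[OF sub]]) (auto simp: K_def m_comm)
  have N1: "N > 1" unfolding N_def using p1 e0 by (rule one_less_power)
  have "int m > 1" using p p1 m_pos by (cases "m = 1") auto
  then obtain g0 where g0: "g0 \<in> carrier G" "fst (\<phi> g0) = 1" "snd (\<phi> g0) = \<one>\<^bsub>H\<^esub>"
    using splitting_surj[of 1 "\<one>\<^bsub>H\<^esub>"] by auto
  \<comment> \<open>In coordinates \<open>g\<close> is \<open>(r, 1)\<close>; it generates the
    subgroup of order \<open>N\<close> in the cyclic factor.\<close>
  define g where "g = g0 [^] r"
  have g: "g \<in> carrier G" using g0 by (simp add: g_def)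
  have g_pow: "fst (\<phi> (g [^] i)) = int r * i mod int m" "snd (\<phi> (g [^] i)) = \<one>\<^bsub>H\<^esub>" for i :: int
    using g0 by (auto simp: g_def int_pow_pow fst_pow snd_pow simp flip: int_pow_int)
  have g_mod: "g [^] (i mod int (N)) = g [^] i" for i :: int
  proof -
    have "g [^] (int (N)) = \<one>"
      by (rule splitting_eqI) (use g g_pow fst_one snd_one mN in \<open>auto simp: mult.commute\<close>)
    then have "g [^] (int (N) * (i div int (N))) = \<one>" using g by (simp flip: int_pow_pow)
    moreover have "g [^] i = g [^] (int (N) * (i div int (N))) \<otimes> g [^] (i mod int (N))"
      using g by (simp flip: int_pow_mult)
    ultimately show ?thesis using g by simp
  qed
  have cop: "coprime (int r) (int (N))"
    unfolding N_def using r(2) p(1) by (metis coprime_commute coprime_int_iff coprime_power_right_iff prime_imp_coprime)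
  let ?\<psi> = "\<lambda>(i, y). g [^] (i::int) \<otimes> y"
  have K_carrier: "\<And>y. y \<in> K \<Longrightarrow> y \<in> carrier G" by (simp add: K_def)
  have pe0: "N \<noteq> 0" using N1 by simp
  have "?\<psi> \<in> hom (integer_mod_group (N) \<times>\<times> H') G"
  proof (rule homI)
    fix x assume "x \<in> carrier (integer_mod_group (N) \<times>\<times> H')"
    then show "?\<psi> x \<in> carrier G" using g K_carrier by (auto simp: H'_def)
  next
    fix x y assume "x \<in> carrier (integer_mod_group (N) \<times>\<times> H')" "y \<in> carrier (integer_mod_group (N) \<times>\<times> H')"
    then obtain i a j b where xy: "x = (i, a)" "y = (j, b)" "a \<in> carrier G" "b \<in> carrier G"
      using K_carrier by (auto simp: H'_def)
    have "g [^] ((i + j) mod int (N)) = g [^] i \<otimes> g [^] j"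
      using g g_mod by (simp add: int_pow_mult)
    then show "?\<psi> (x \<otimes>\<^bsub>integer_mod_group (N) \<times>\<times> H'\<^esub> y) = ?\<psi> x \<otimes> ?\<psi> y"
      using g xy by (simp add: H'_def m_ac)
  qed
  moreover have "inj_on ?\<psi> (carrier (integer_mod_group (N) \<times>\<times> H'))"
  proof (rule inj_onI)
    fix x y assume "x \<in> carrier (integer_mod_group (N) \<times>\<times> H')" "y \<in> carrier (integer_mod_group (N) \<times>\<times> H')"
      and eq: "?\<psi> x = ?\<psi> y"
    then obtain i a j b where xy: "x = (i, a)" "y = (j, b)" "a \<in> K" "b \<in> K"
        "0 \<le> i" "i < int (N)" "0 \<le> j" "j < int (N)"
      using pe0 by (auto simp: H'_def carrier_integer_mod_group)
    \<comment> \<open>Elements of \<open>K\<close> vanish modulo \<open>N\<close> in the first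
      coordinate, so only \<open>r * i\<close> remains, and \<open>r\<close> is a unit modulo
      \<open>N\<close>.\<close>
    have res: "[fst (\<phi> (g [^] i \<otimes> a)) = int r * i] (mod int (N))" if "a \<in> K" for i :: int and a
    proof -
      have "[fst (\<phi> (g [^] i \<otimes> a)) = int r * i + fst (\<phi> a)] (mod int m)"
        using that K_carrier g g_pow by (simp add: fst_mult cong_def mod_add_left_eq)
      then have "[fst (\<phi> (g [^] i \<otimes> a)) = int r * i + fst (\<phi> a)] (mod int (N))"
        using pem by (rule cong_dvd_modulus)
      moreover have "[int r * i + fst (\<phi> a) = int r * i] (mod int (N))"
        using that by (simp add: K_def cong_iff_dvd_diff)
      ultimately show ?thesis by (rule cong_trans)
    qed
    have "[int r * i = int r * j] (mod int (N))"
      using res[OF xy(3), of i] res[OF xy(4), of j] eq xy(1,2) by (metis case_prod_conv cong_sym cong_trans)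
    then have "[i = j] (mod int (N))" using cop by (simp add: cong_mult_lcancel)
    then have "i = j" using xy by (simp add: cong_def)
    then show "x = y" using eq xy g K_carrier by simp
  qed
  moreover have "carrier G \<subseteq> ?\<psi> ` carrier (integer_mod_group (N) \<times>\<times> H')"
  proof
    fix x assume x: "x \<in> carrier G"
    \<comment> \<open>The exponent makes a power of \<open>g\<close> match \<open>x\<close> in the
      first coordinate modulo \<open>N\<close>; the remaining factor then lies in
      \<open>K\<close>.\<close>
    obtain i' where i': "[int r * i' = fst (\<phi> x)] (mod int (N))"
      using cong_solve_coprime_int[OF cop] by (metis cong_scalar_left mult.assoc mult.commute mult.right_neutral)
    define i where "i = i' mod int (N)"
    have i: "0 \<le> i" "i < int (N)" using N1 by (auto simp: i_def)
    have ir: "[int r * i = fst (\<phi> x)] (mod int (N))"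
      using i' by (simp add: i_def cong_def mod_mult_right_eq)
    define y where "y = g [^] (- i) \<otimes> x"
    have "int (N) dvd int r * (- i) mod int m + fst (\<phi> x)"
    proof -
      have "[int r * (- i) mod int m = int r * (- i)] (mod int (N))"
        using pem by (metis cong_dvd_modulus cong_mod_left cong_refl)
      then have "[int r * (- i) mod int m + fst (\<phi> x) = int r * (- i) + int r * i] (mod int (N))"
        using ir by (intro cong_add) (auto simp: cong_sym)
      then show ?thesis by (simp add: cong_0_iff)
    qed
    then have "y \<in> K" using g x by (simp add: y_def K_def dvd_mult g_pow)
    moreover have "x = ?\<psi> (i, y)" using g x by (simp add: y_def m_assoc[symmetric] int_pow_neg)
    ultimately show "x \<in> ?\<psi> ` carrier (integer_mod_group (N) \<times>\<times> H')"
      using i pe0 by (intro image_eqI[of _ _ "(i, y)"]) (auto simp: H'_def carrier_integer_mod_group)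
  qed
  ultimately have "?\<psi> \<in> iso (integer_mod_group (N) \<times>\<times> H') G"
    unfolding iso_def bij_betw_def by (auto simp: hom_def Pi_iff)
  then have "integer_mod_group (N) \<times>\<times> H' \<cong> G" by (rule is_isoI)
  then have iso: "G \<cong> integer_mod_group (N) \<times>\<times> H'"
    using group.iso_sym DirProd_group comm comm_group.axioms(2) group_integer_mod_group by blast
  \<comment> \<open>The first coordinate of \<open>y\<close> is a multiple of \<open>N\<close>,
    hence of \<open>p\<close>, so \<open>m div p\<close> times it vanishes modulo \<open>m\<close>;
    on the second coordinate the hypothesis on \<open>H\<close> applies.\<close>
  have K_pow: "y [^] (m div p) = \<one>" if y: "y \<in> K" for y
  proof -
    have "y [^] (int (m div p)) = \<one>"
    proof (rule splitting_eqI)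
      have "m div p = p ^ (e - 1) * r" using r e0 p1 by (cases e) auto
      then have "m dvd (m div p) * N" using e0 mN by simp
      then have "int m dvd int (m div p) * int N" by (metis of_nat_dvd_iff of_nat_mult)
      moreover have "int (m div p) * int N dvd int (m div p) * fst (\<phi> y)"
        using y by (simp add: K_def)
      ultimately have "int m dvd int (m div p) * fst (\<phi> y)" by (rule dvd_trans)
      then show "fst (\<phi> (y [^] (int (m div p)))) = fst (\<phi> \<one>)"
        using y by (simp add: fst_pow K_def fst_one)
      show "snd (\<phi> (y [^] (int (m div p)))) = snd (\<phi> \<one>)"
        unfolding snd_pow[OF K_carrier[OF y]] snd_one
        unfolding int_pow_int by (rule H[OF snd_closed[OF K_carrier[OF y]]])
    qed (use y in \<open>auto simp: K_def\<close>)
    then show ?thesis by (simp add: int_pow_int)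
  qed
  have "group_exponent (H'\<lparr>carrier := P\<rparr>) < p ^ e" if P: "sylow_subgroup p H' P" for P
  proof -
    let ?P = "H'\<lparr>carrier := P\<rparr>"
    interpret H': comm_group H' by (rule comm)
    have subP: "subgroup P H'" and card: "card P = p ^ multiplicity p (order H')"
      using P by (auto simp: sylow_subgroup_def)
    interpret PG: group ?P using subP H'.is_group by (rule subgroup.subgroup_is_group)
    have PK: "P \<subseteq> K" using subP subgroup.subset by (force simp: H'_def)
    then have "P \<subseteq> carrier G" using K_carrier by blast
    then have finP: "finite (carrier ?P)" using finite_G finite_subset by auto
    have "y [^]\<^bsub>?P\<^esub> (p ^ (e - 1)) = \<one>\<^bsub>?P\<^esub>" if y: "y \<in> carrier ?P" for y
    proof -
      have yK: "y \<in> K" using y PK by auto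
      have "y [^]\<^bsub>?P\<^esub> (m div p) = \<one>\<^bsub>?P\<^esub>"
        using K_pow[OF yK] by (simp add: H'_def nat_pow_consistent[symmetric])
      then have 1: "PG.ord y dvd m div p" using y PG.pow_eq_id by blast
      have "PG.ord y dvd p ^ multiplicity p (order H')"
        using PG.ord_dvd_group_order[OF y] card by (simp add: order_def)
      then obtain j where j: "PG.ord y = p ^ j" using p(1) divides_primepow_nat by blast
      have "m div p = p ^ (e - 1) * r" using r e0 p1 by (cases e) auto
      moreover have "coprime (p ^ j) r" using r(2) p(1) by (metis coprime_power_left_iff prime_imp_coprime)
      ultimately have "PG.ord y dvd p ^ (e - 1)" using 1 j by (simp add: coprime_dvd_mult_left_iff)
      then show ?thesis using y PG.pow_eq_id by blast
    qed
    then have "group_exponent ?P dvd p ^ (e - 1)" by (rule PG.group_exponent_dvd[OF finP])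
    then have "group_exponent ?P \<le> p ^ (e - 1)" using p1 by (intro dvd_imp_le) auto
    also have "\<dots> < p ^ e" using e0 p1 by (intro power_strict_increasing) auto
    finally show ?thesis .
  qed
  then show ?thesis using comm iso unfolding N_def by blast
qed

end

section \<open>The multiplier group\<close>

lemma multiplier_one:
  fixes G (structure)
  assumes "comm_group G" "D \<subseteq> carrier G"
  shows "multiplier G D 1"
proof -
  interpret comm_group G by fact
  have "(\<lambda>d. d [^] (1::int)) ` D = D" using assms(2) by force
  moreover have "D #> \<one> = D" using assms(2) by (rule coset_mult_one)
  ultimately show ?thesis by (auto simp: multiplier_def intro!: bexI[of _ \<one>])
qed

text \<open>The \<open>t\<close>-th power map turns translation by \<open>g\<close> into translation
  by \<open>g [^] t\<close>, which adds to the translation by \<open>h\<close> belonging to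
  \<open>t\<close>.\<close>

lemma multiplier_mult:
  fixes G (structure)
  assumes "comm_group G" "D \<subseteq> carrier G" "multiplier G D s" "multiplier G D t"
  shows "multiplier G D (s * t)"
proof -
  interpret comm_group G by fact
  obtain g h where g: "g \<in> carrier G" "(\<lambda>d. d [^] s) ` D = D #> g"
    and h: "h \<in> carrier G" "(\<lambda>d. d [^] t) ` D = D #> h"
    using assms(3,4) by (auto simp: multiplier_def)
  have D: "\<And>d. d \<in> D \<Longrightarrow> d \<in> carrier G" using assms(2) by blast
  have im: "D #> g = (\<lambda>x. x \<otimes> g) ` D" for g by (auto simp: r_coset_def)
  have "(\<lambda>d. d [^] (s * t)) ` D = (\<lambda>d. d [^] t) ` (\<lambda>d. d [^] s) ` D"
    unfolding image_image using D by (intro image_cong refl) (simp add: int_pow_pow)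
  also have "\<dots> = (\<lambda>d. d [^] t \<otimes> g [^] t) ` D"
    unfolding g(2) im image_image using D g by (intro image_cong refl) (simp add: int_pow_distrib)
  also have "\<dots> = (\<lambda>x. x \<otimes> g [^] t) ` (\<lambda>d. d [^] t) ` D" by (simp add: image_image)
  also have "\<dots> = D #> (h \<otimes> g [^] t)"
    unfolding h(2) im image_image using D g h by (intro image_cong refl) (simp add: m_assoc)
  finally have "(\<lambda>d. d [^] (s * t)) ` D = D #> (h \<otimes> g [^] t)" .
  then show ?thesis
    using assms(3,4) g h by (auto simp: multiplier_def)
qed

lemma multiplier_power:
  fixes G (structure)
  assumes "comm_group G" "D \<subseteq> carrier G" "multiplier G D t"
  shows "multiplier G D (t ^ n)"
  using assms by (induction n) (auto intro: multiplier_one multiplier_mult)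

lemma group_unit_group_mod:
  assumes "n > 1"
  shows "group (unit_group_mod n)"
proof -
  interpret residues "int n" "residue_ring (int n)" using assms by (auto simp: residues_def)
  show ?thesis by (rule units_group)
qed

lemma carrier_unit_group_mod:
  assumes "n > 1"
  shows "carrier (unit_group_mod n) = {x. 0 < x \<and> x < int n \<and> coprime x (int n)}"
proof -
  interpret residues "int n" "residue_ring (int n)" using assms by (auto simp: residues_def)
  show ?thesis using res_units_eq by (simp add: units_of_carrier)
qed

lemma mod_mem_unit_group_mod:
  assumes "n > 1" "coprime x (int n)"
  shows "x mod int n \<in> carrier (unit_group_mod n)"
proof -
  interpret residues "int n" "residue_ring (int n)" using assms by (auto simp: residues_def)
  show ?thesis using assms by (simp add: units_of_carrier)
qed

lemma mult_unit_group_mod: "x \<otimes>\<^bsub>unit_group_mod n\<^esub> y = x * y mod int n"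
  by (simp add: units_of_mult residue_ring_def)

lemma one_unit_group_mod: "\<one>\<^bsub>unit_group_mod n\<^esub> = 1"
  by (simp add: units_of_one residue_ring_def)

lemma card_unit_group_mod:
  assumes "n > 1"
  shows "finite (carrier (unit_group_mod n))" "card (carrier (unit_group_mod n)) = totient n"
proof -
  interpret residues "int n" "residue_ring (int n)" using assms by (auto simp: residues_def)
  show "finite (carrier (unit_group_mod n))" "card (carrier (unit_group_mod n)) = totient n"
    using totient_eq finite_Units by (auto simp: units_of_carrier)
qed

lemma subgroup_multipliers:
  fixes G (structure)
  assumes G: "comm_group G" "D \<subseteq> carrier G" and n: "n > 1" "n dvd order G"
  shows "subgroup ((\<lambda>t. t mod int n) ` {t. multiplier G D t}) (unit_group_mod n)"
    (is "subgroup ?M ?U")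
proof -
  interpret U: group ?U using n(1) by (rule group_unit_group_mod)
  have cop: "coprime t (int n)" if "multiplier G D t" for t
    using that n(2) unfolding multiplier_def
    by (meson coprime_divisors dvd_refl int_dvd_int_iff)
  show ?thesis
  proof (rule U.subgroupI)
    show "?M \<subseteq> carrier ?U" using cop n(1) mod_mem_unit_group_mod by blast
    show "?M \<noteq> {}" using multiplier_one[OF G] by blast
  next
    fix a b assume "a \<in> ?M" "b \<in> ?M"
    then obtain s t where "multiplier G D s" "multiplier G D t" "a = s mod int n" "b = t mod int n"
      by blast
    then show "a \<otimes>\<^bsub>?U\<^esub> b \<in> ?M"
      using multiplier_mult[OF G] by (auto simp: mult_unit_group_mod mod_mult_eq)
  next
    fix a assume "a \<in> ?M"
    then obtain t where t: "multiplier G D t" "a = t mod int n" by blast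
    have a: "a \<in> carrier ?U" using t cop n(1) mod_mem_unit_group_mod by blast
    have tot: "totient n > 0" using n by simp
    \<comment> \<open>By Euler's theorem the inverse of \<open>t\<close> is a power of
      \<open>t\<close>, hence again a multiplier.\<close>
    have "[t ^ totient n = 1] (mod int n)"
      using residues.euler_theorem[of "int n" t] n(1) cop[OF t(1)] by (simp add: residues_def)
    then have "[t ^ (totient n - 1) * t = 1] (mod int n)"
      using tot by (metis Suc_diff_1 power_Suc2)
    then have "(t ^ (totient n - 1) mod int n) \<otimes>\<^bsub>?U\<^esub> a = \<one>\<^bsub>?U\<^esub>"
      using n(1) t(2) by (simp add: mult_unit_group_mod one_unit_group_mod cong_def mod_mult_eq)
    moreover have "t ^ (totient n - 1) mod int n \<in> ?M"
      using multiplier_power[OF G t(1)] by blast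
    moreover have "?M \<subseteq> carrier ?U" using cop n(1) mod_mem_unit_group_mod by blast
    ultimately show "inv\<^bsub>?U\<^esub> a \<in> ?M" using U.inv_equality a by (metis subsetD)
  qed
qed

text \<open>Reduction modulo \<open>c\<close> is a homomorphism because \<open>c dvd n\<close>, and
  \<open>triv\<close> says that its kernel on \<open>M\<close> is trivial; \<open>K\<close> is the
  image.\<close>

lemma subgroup_reduction_embedding:
  fixes n c :: nat
  assumes n: "n > 1" and c: "c > 1" "c dvd n" and M: "subgroup M (unit_group_mod n)"
    and triv: "\<And>x. x \<in> M \<Longrightarrow> x mod int c = 1 \<Longrightarrow> x = 1"
  shows "\<exists>K. subgroup K (unit_group_mod c) \<and>
    (unit_group_mod n)\<lparr>carrier := M\<rparr> \<cong> (unit_group_mod c)\<lparr>carrier := K\<rparr>"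
    and "card M \<le> totient c"
proof -
  let ?U = "unit_group_mod n" and ?V = "unit_group_mod c"
  let ?M = "?U\<lparr>carrier := M\<rparr>"
  let ?f = "\<lambda>x. x mod int c"
  interpret U: group ?U using n by (rule group_unit_group_mod)
  interpret V: group ?V using c(1) by (rule group_unit_group_mod)
  interpret MG: group ?M using M U.is_group by (rule subgroup.subgroup_is_group)
  have "?f x \<in> carrier ?V" if "x \<in> M" for x
  proof -
    have "x \<in> carrier ?U" using that M subgroup.subset by blast
    then have "coprime x (int n)" using n by (simp add: carrier_unit_group_mod)
    then have "coprime x (int c)" using c(2) by (meson coprime_divisors dvd_refl int_dvd_int_iff)
    then show ?thesis using c(1) mod_mem_unit_group_mod by blast
  qed
  moreover have "?f (x * y mod int n) = ?f x * ?f y mod int c" for x y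
    using c(2) by (simp add: mod_mod_cancel mod_mult_eq)
  ultimately have hom: "?f \<in> hom ?M ?V" by (auto simp: hom_def mult_unit_group_mod)
  interpret f: group_hom ?M ?V ?f by unfold_locales (rule hom)
  have "inj_on ?f (carrier ?M)"
    using f.inj_on_one_iff triv by (simp add: one_unit_group_mod)
  then have inj: "inj_on ?f M" by simp
  have im: "subgroup (?f ` M) ?V" using f.img_is_subgroup by simp
  have "?f \<in> iso ?M (?V\<lparr>carrier := ?f ` M\<rparr>)"
    using hom inj by (auto simp: iso_def hom_def bij_betw_def)
  then show "\<exists>K. subgroup K ?V \<and> ?M \<cong> ?V\<lparr>carrier := K\<rparr>"
    using im is_isoI by blast
  have "card M = card (?f ` M)" using inj by (simp add: card_image)
  also have "\<dots> \<le> card (carrier ?V)"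
    using im card_unit_group_mod(1)[OF c(1)] by (intro card_mono subgroup.subset)
  finally show "card M \<le> totient c" using card_unit_group_mod(2)[OF c(1)] by simp
qed

section \<open>Difference sets with a multiplier of prime order\<close>

text \<open>Cauchy-Schwarz against the constant 1, by expanding the sum of
  \<open>(f i - f j) ^ 2\<close> over all pairs.\<close>

lemma square_sum_le_card_sum_squares:
  fixes f :: "'a \<Rightarrow> int"
  assumes "finite S"
  shows "(\<Sum>i\<in>S. f i)\<^sup>2 \<le> int (card S) * (\<Sum>i\<in>S. (f i)\<^sup>2)"
proof -
  have "0 \<le> (\<Sum>i\<in>S. \<Sum>j\<in>S. (f i - f j)\<^sup>2)"
    by (intro sum_nonneg) auto
  also have "\<dots> = (\<Sum>i\<in>S. \<Sum>j\<in>S. (f i)\<^sup>2 + (f j)\<^sup>2 - 2 * (f i * f j))"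
    by (intro sum.cong refl) (simp add: power2_diff)
  also have "\<dots> = 2 * (int (card S) * (\<Sum>i\<in>S. (f i)\<^sup>2)) - 2 * (\<Sum>i\<in>S. f i)\<^sup>2"
  proof -
    have "(\<Sum>i\<in>S. f i)\<^sup>2 = (\<Sum>i\<in>S. \<Sum>j\<in>S. f i * f j)"
      by (simp add: power2_eq_square sum_product)
    then show ?thesis
      by (simp add: sum.distrib sum_subtractf) (simp add: sum_distrib_left)
  qed
  finally show ?thesis by simp
qed

text \<open>Multiply \<open>2 * k \<le> v - 1\<close> by \<open>l\<close>, replace
  \<open>l * (v - 1)\<close> by \<open>k * (k - 1)\<close> and cancel \<open>k\<close>, which is
  positive because \<open>k - l > 1\<close>.\<close>

lemma parameters_less:
  fixes k l v :: int
  assumes eq: "k * (k - 1) = l * (v - 1)" and "2 * k < v" "0 \<le> l" "k - l > 1"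
  shows "2 * l \<le> k - 1"
proof -
  have "k * (2 * l) \<le> l * (v - 1)"
    using mult_left_mono[of "2 * k" "v - 1" l] assms by (simp add: algebra_simps)
  then have "k * (2 * l) \<le> k * (k - 1)" using eq by simp
  moreover have "k > 0" using assms by linarith
  ultimately show ?thesis by (metis mult_le_cancel_left_pos)
qed

text \<open>With \<open>r = q - 1\<close>, the counting identities combine to
  \<open>(r k - (r + 1) b)\<^sup>2 \<le> r\<^sup>2 (k - l)\<close>, which for \<open>r \<ge> 2\<close> is incompatible with \<open>b \<le> l\<close>.\<close>

lemma no_odd_parameters:
  fixes k l b w r S :: int
  assumes basic: "k * (k - 1) = l * ((r + 1) * w - 1)" and "2 * k < (r + 1) * w"
    and "0 \<le> b" "b \<le> l" and "k - l > 1" and cs: "b\<^sup>2 \<le> r * S"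
    and sq: "(k - b)\<^sup>2 + S = k + l * (w - 1)" and r: "r \<ge> 2"
  shows False
proof -
  define n where "n = k - l"
  have "2 * l \<le> k - 1" using parameters_less[OF basic] assms by simp
  then have ln: "l \<le> n - 1" by (simp add: n_def)
  \<comment> \<open>The factor \<open>r + 1\<close> brings in the group order
    \<open>(r + 1) * w\<close>, so that \<open>basic\<close> can eliminate \<open>w\<close>.\<close>
  have "r * ((r + 1) * ((k - b)\<^sup>2 + S)) = r * ((r + 1) * k + (l * ((r + 1) * w - 1)) + l - (r + 1) * l)"
    unfolding sq by (simp add: algebra_simps)
  also have "\<dots> = r\<^sup>2 * n + r * k\<^sup>2"
    unfolding basic[symmetric] n_def by (simp add: algebra_simps power2_eq_square)
  finally have "r * (r + 1) * (k - b)\<^sup>2 + (r + 1) * (r * S) = r\<^sup>2 * n + r * k\<^sup>2"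
    by (simp add: algebra_simps)
  moreover have "(r + 1) * b\<^sup>2 \<le> (r + 1) * (r * S)" using cs r by (simp add: mult_left_mono)
  ultimately have "r * (r + 1) * (k - b)\<^sup>2 + (r + 1) * b\<^sup>2 - r * k\<^sup>2 \<le> r\<^sup>2 * n" by linarith
  moreover have "r * (r + 1) * (k - b)\<^sup>2 + (r + 1) * b\<^sup>2 - r * k\<^sup>2 = (r * k - (r + 1) * b)\<^sup>2"
    by (simp add: power2_eq_square algebra_simps)
  ultimately have le: "(r * k - (r + 1) * b)\<^sup>2 \<le> r\<^sup>2 * n" by simp
  have "(r + 1) * b \<le> (r + 1) * l" using assms by (simp add: mult_left_mono)
  \<comment> \<open>Uses \<open>r * k - (r + 1) * l = r * n - l\<close> and
    \<open>l \<le> n - 1\<close>.\<close>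
  then have "(r - 1) * n + 1 \<le> r * k - (r + 1) * b"
    using ln by (simp add: n_def algebra_simps)
  moreover have "0 \<le> (r - 1) * n + 1" using r assms by (simp add: n_def)
  ultimately have "((r - 1) * n + 1)\<^sup>2 \<le> (r * k - (r + 1) * b)\<^sup>2" by (rule power_mono)
  then have "((r - 1) * n + 1)\<^sup>2 - r\<^sup>2 * n \<le> 0" using le by linarith
  \<comment> \<open>The difference factors, and both factors are positive for \<open>n > 1\<close>
    and \<open>r \<ge> 2\<close>.\<close>
  moreover have "((r - 1) * n + 1)\<^sup>2 - r\<^sup>2 * n = (n - 1) * ((r - 1)\<^sup>2 * n - 1)"
    by (simp add: power2_eq_square algebra_simps)
  moreover have "0 < (n - 1) * ((r - 1)\<^sup>2 * n - 1)"
  proof (rule mult_pos_pos)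
    show "0 < n - 1" using assms by (simp add: n_def)
    have "1 * n \<le> (r - 1)\<^sup>2 * n"
      using r assms by (intro mult_right_mono) (auto simp: n_def intro: one_le_power)
    then show "0 < (r - 1)\<^sup>2 * n - 1" using \<open>k - l > 1\<close> n_def by linarith
  qed
  ultimately show False by linarith
qed

text \<open>For \<open>q = 2\<close> the two fibres of \<open>D\<close> have sizes
  \<open>k - b\<close> and \<open>b\<close>, and their difference \<open>u\<close> satisfies
  \<open>u ^ 2 = k - l\<close>. The bound \<open>b \<le> l\<close> gives
  \<open>l \<ge> u ^ 2 - u\<close>, the bound \<open>low\<close> gives the reverse, and this
  determines all parameters.\<close>

lemma hadamard_parameters:
  fixes k l b w :: int
  assumes basic: "k * (k - 1) = l * (2 * w - 1)" and "2 * k < 2 * w"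
    and "0 \<le> b" "b \<le> l" and "k - l > 1" and low: "2 * k - l - w \<le> b"
    and sq: "(k - b)\<^sup>2 + b\<^sup>2 = k + l * (w - 1)"
  shows "\<exists>u>1. 2 * w = 4 * u\<^sup>2 \<and> k = 2 * u\<^sup>2 - u \<and> l = u\<^sup>2 - u"
proof -
  define u where "u = k - 2 * b"
  have l2: "2 * l \<le> k - 1" using parameters_less[OF basic] assms by simp
  then have upos: "u > 0" using assms by (simp add: u_def)
  have "u\<^sup>2 = 2 * ((k - b)\<^sup>2 + b\<^sup>2) - k\<^sup>2" by (simp add: u_def power2_eq_square algebra_simps)
  also have "\<dots> = 2 * k - 2 * l + (l * (2 * w - 1) + l) - k\<^sup>2" unfolding sq by (simp add: algebra_simps)
  also have "\<dots> = k - l" unfolding basic[symmetric] by (simp add: power2_eq_square algebra_simps)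
  finally have n: "k = u\<^sup>2 + l" by simp
  have u1: "u > 1"
  proof (rule ccontr)
    assume "\<not> u > 1"
    then have "u = 1" using upos by simp
    then show False using n \<open>k - l > 1\<close> by simp
  qed
  have lower: "u\<^sup>2 - u \<le> l" using \<open>b \<le> l\<close> n u_def by linarith
  \<comment> \<open>Substitutes \<open>2 * b = k - u\<close> and \<open>k = u ^ 2 + l\<close> into
    twice the inequality \<open>low\<close>.\<close>
  have vlow: "3 * u\<^sup>2 + l + u \<le> 2 * w" using low n u_def by linarith
  have lv: "l * (2 * w) = (u\<^sup>2 + l)\<^sup>2 - u\<^sup>2"
    using basic n by (simp add: power2_eq_square algebra_simps)
  have "l * (3 * u\<^sup>2 + l + u) \<le> (u\<^sup>2 + l)\<^sup>2 - u\<^sup>2"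
    unfolding lv[symmetric] using vlow assms by (simp add: mult_left_mono)
  \<comment> \<open>Cancelling common terms leaves
    \<open>(u ^ 2 + u) * l \<le> u ^ 4 - u ^ 2\<close>, and \<open>u * (u + 1)\<close> divides both
    sides.\<close>
  then have "(u * (u + 1)) * l \<le> (u * (u + 1)) * (u\<^sup>2 - u)"
    by (simp add: power2_eq_square algebra_simps)
  then have "l \<le> u\<^sup>2 - u" using u1 by (simp add: mult_le_cancel_left)
  then have l: "l = u\<^sup>2 - u" using lower by simp
  have lpos: "l > 0" using l u1 by (simp add: power2_eq_square)
  have "l * (2 * w) = l * (4 * u\<^sup>2)"
    unfolding lv by (simp add: l power2_eq_square algebra_simps)
  then have "2 * w = 4 * u\<^sup>2" using lpos by simp
  then show ?thesis using l n u1 by auto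
qed

section \<open>Difference sets, pair counts and fixed translates\<close>

locale diff_set = comm_group G for G (structure) +
  fixes D :: "'a set" and k l :: nat
  assumes finite_G: "finite (carrier G)"
    and D_subset: "D \<subseteq> carrier G"
    and card_D: "card D = k"
    and shift: "\<And>g. g \<in> carrier G \<Longrightarrow> g \<noteq> \<one> \<Longrightarrow> card {x \<in> D. x \<otimes> g \<in> D} = l"

lemma difference_set_imp_diff_set:
  fixes G (structure)
  assumes "difference_set G v k l D"
  shows "diff_set G D k l"
proof -
  interpret comm_group G using assms by (simp add: difference_set_def)
  show ?thesis
  proof
    show "finite (carrier G)" "D \<subseteq> carrier G" "card D = k"
      using assms by (auto simp: difference_set_def)
    then have DG: "\<And>x. x \<in> D \<Longrightarrow> x \<in> carrier G" by auto
    fix g assume g: "g \<in> carrier G" "g \<noteq> \<one>"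
    \<comment> \<open>A pair with quotient \<open>g\<close> is determined by its second entry, so
      pairs can be counted as points of \<open>D\<close> that the shift by \<open>g\<close> keeps in
      \<open>D\<close>.\<close>
    have "bij_betw (\<lambda>x. (x \<otimes> g, x)) {x \<in> D. x \<otimes> g \<in> D}
        {(d1, d2). d1 \<in> D \<and> d2 \<in> D \<and> d1 \<otimes> inv d2 = g}"
    proof (rule bij_betwI[where g = snd])
      show "(\<lambda>x. (x \<otimes> g, x)) \<in> {x \<in> D. x \<otimes> g \<in> D} \<rightarrow> {(d1, d2). d1 \<in> D \<and> d2 \<in> D \<and> d1 \<otimes> inv d2 = g}"
        using g DG by (auto simp: m_comm[of _ g] m_assoc)
      show "snd \<in> {(d1, d2). d1 \<in> D \<and> d2 \<in> D \<and> d1 \<otimes> inv d2 = g} \<rightarrow> {x \<in> D. x \<otimes> g \<in> D}"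
        using DG by (auto simp: m_lcomm)
    next
      fix y assume "y \<in> {(d1, d2). d1 \<in> D \<and> d2 \<in> D \<and> d1 \<otimes> inv d2 = g}"
      then show "(snd y \<otimes> g, snd y) = y"
        using DG by (auto simp: m_lcomm)
    qed auto
    then show "card {x \<in> D. x \<otimes> g \<in> D} = l"
      using assms g by (simp add: bij_betw_same_card difference_set_def)
  qed
qed

context diff_set
begin

lemma finite_D: "finite D"
  using finite_G D_subset finite_subset by blast

lemma D_carrier: "x \<in> D \<Longrightarrow> x \<in> carrier G"
  using D_subset by blast

lemma card_shift:
  assumes "g \<in> carrier G"
  shows "card {x \<in> D. x \<otimes> g \<in> D} = (if g = \<one> then k else l)"
proof (cases "g = \<one>")
  case True
  then have "{x \<in> D. x \<otimes> g \<in> D} = D" using D_carrier by auto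
  then show ?thesis using True card_D by simp
qed (use shift assms in auto)

lemma translate:
  assumes h: "h \<in> carrier G"
  shows "diff_set G (D #> h) k l"
proof
  show "finite (carrier G)" by (rule finite_G)
  show "D #> h \<subseteq> carrier G" using D_subset h by (rule r_coset_subset_G)
  have inj: "inj_on (\<lambda>x. x \<otimes> h) D"
    using D_carrier h by (auto intro!: inj_onI)
  have im: "D #> h = (\<lambda>x. x \<otimes> h) ` D" by (auto simp: r_coset_def)
  show "card (D #> h) = k"
    using card_D card_image[OF inj] im by simp
  fix g assume g: "g \<in> carrier G" "g \<noteq> \<one>"
  have *: "x \<otimes> h \<otimes> g \<in> D #> h \<longleftrightarrow> x \<otimes> g \<in> D" if "x \<in> D" for x
  proof -
    have x: "x \<in> carrier G" using that D_carrier by auto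
    have "x \<otimes> h \<otimes> g = x \<otimes> g \<otimes> h" using x g h by (simp add: m_assoc m_comm[of h g])
    then show ?thesis using x g h D_carrier by (auto simp: im)
  qed
  have "{y \<in> D #> h. y \<otimes> g \<in> D #> h} = (\<lambda>x. x \<otimes> h) ` {x \<in> D. x \<otimes> g \<in> D}"
    using * by (auto simp: im)
  moreover have "inj_on (\<lambda>x. x \<otimes> h) {x \<in> D. x \<otimes> g \<in> D}"
    using inj by (rule inj_on_subset) auto
  ultimately show "card {y \<in> D #> h. y \<otimes> g \<in> D #> h} = l"
    using shift[OF g] by (simp add: card_image)
qed

lemma sum_card_shift:
  assumes S: "S \<subseteq> carrier G" and "\<one> \<in> S"
  shows "(\<Sum>g\<in>S. card {x \<in> D. x \<otimes> g \<in> D}) = k + l * (card S - 1)"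
proof -
  have fin: "finite S" using S finite_G finite_subset by blast
  have "(\<Sum>g\<in>S. card {x \<in> D. x \<otimes> g \<in> D}) = (\<Sum>g\<in>S. if g = \<one> then k else l)"
    using S by (intro sum.cong refl card_shift) auto
  also have "\<dots> = k + (\<Sum>g\<in>S - {\<one>}. if g = \<one> then k else l)"
    using fin assms(2) by (subst sum.remove[of _ \<one>]) auto
  also have "(\<Sum>g\<in>S - {\<one>}. if g = \<one> then k else l) = (\<Sum>g\<in>S - {\<one>}. l)"
    by (intro sum.cong) auto
  finally show ?thesis using fin assms(2) by simp
qed

text \<open>Sort the pairs by their quotient: the identity arises \<open>k\<close> times, any other
  element \<open>l\<close> times. \<open>S = carrier G\<close> gives the basic equation, the kernel
  of a power map gives the fibre identity.\<close>

lemma card_quotient_pairs: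
  assumes S: "S \<subseteq> carrier G" and "\<one> \<in> S"
  shows "(\<Sum>x\<in>D. card {y \<in> D. inv x \<otimes> y \<in> S}) = k + l * (card S - 1)"
proof -
  have fin: "finite S" using S finite_G finite_subset by blast
  have "card {y \<in> D. inv x \<otimes> y \<in> S} = card {g \<in> S. x \<otimes> g \<in> D}" if "x \<in> D" for x
  proof (rule bij_betw_same_card, rule bij_betwI[where f = "\<lambda>y. inv x \<otimes> y" and g = "\<lambda>g. x \<otimes> g"])
  qed (use that D_carrier S in \<open>auto simp: m_assoc[symmetric] subset_iff\<close>)
  then have "(\<Sum>x\<in>D. card {y \<in> D. inv x \<otimes> y \<in> S}) = (\<Sum>x\<in>D. card {g \<in> S. x \<otimes> g \<in> D})"
    by simp
  also have "\<dots> = (\<Sum>g\<in>S. card {x \<in> D. x \<otimes> g \<in> D})"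
    by (rule sum_multicount_gen) (use fin finite_D in auto)
  finally show ?thesis using sum_card_shift[OF assms] by simp
qed

lemma basic_equation: "k * (k - 1) = l * (order G - 1)"
proof -
  have "{y \<in> D. inv x \<otimes> y \<in> carrier G} = D" if "x \<in> D" for x
    using that D_carrier by auto
  then have "(\<Sum>x\<in>D. card {y \<in> D. inv x \<otimes> y \<in> carrier G}) = k * k"
    using card_D by simp
  with card_quotient_pairs[of "carrier G"] show ?thesis
    by (simp add: order_def diff_mult_distrib2)
qed

text \<open>Inclusion-exclusion for \<open>D\<close> and its translate by \<open>inv g\<close>,
  which meet in \<open>l\<close> points.\<close>

lemma card_shift_complement:
  assumes "g \<in> carrier G" "g \<noteq> \<one>"
  shows "int (card {x \<in> carrier G - D. x \<otimes> g \<notin> D}) = int (order G) - 2 * int k + int l"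
proof -
  let ?A = "{x \<in> carrier G. x \<otimes> g \<in> D}"
  have "bij_betw (\<lambda>x. x \<otimes> g) ?A D"
    by (rule bij_betwI[where g = "\<lambda>x. x \<otimes> inv g"]) (use assms D_carrier in \<open>auto simp: m_assoc\<close>)
  then have A: "card ?A = k" using card_D by (simp add: bij_betw_same_card)
  have fin: "finite ?A" using finite_G by simp
  have eq: "{x \<in> carrier G - D. x \<otimes> g \<notin> D} = carrier G - (D \<union> ?A)" by auto
  have sub: "D \<union> ?A \<subseteq> carrier G" using D_carrier by auto
  have int: "D \<inter> ?A = {x \<in> D. x \<otimes> g \<in> D}" using D_carrier by auto
  have 1: "card (D \<union> ?A) + l = 2 * k"
    using card_Un_Int[OF finite_D fin] A card_D shift[OF assms] by (simp add: int)
  have 2: "card (D \<union> ?A) \<le> card (carrier G)" using sub finite_G by (rule card_mono[rotated])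
  have "card (carrier G - (D \<union> ?A)) = card (carrier G) - card (D \<union> ?A)"
    by (rule card_Diff_subset) (use sub fin finite_D in auto)
  then show ?thesis using 1 2 unfolding eq order_def by linarith
qed

text \<open>A multiplier fixes as many points of the design as blocks; it fixes the point \<open>\<one>\<close>,
  so it fixes some translate of \<open>D\<close>.\<close>

lemma exists_fixed_translate:
  fixes t :: int
  assumes "l < k" and g: "g \<in> carrier G" and img: "(\<lambda>d. d [^] t) ` D = D #> g"
  shows "\<exists>h\<in>carrier G. \<forall>x\<in>D #> h. x [^] t \<in> D #> h"
proof -
  have im: "D #> h = (\<lambda>x. x \<otimes> h) ` D" for h by (auto simp: r_coset_def)
  have inj_tr: "inj_on (\<lambda>x. x \<otimes> h) D" if "h \<in> carrier G" for h
    using D_carrier that by (auto intro!: inj_onI)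
  have inj: "inj_on (\<lambda>d. d [^] t) D"
    by (rule eq_card_imp_inj_on[OF finite_D]) (simp add: img im card_image[OF inj_tr[OF g]])
  have block: "card {d \<in> D. d [^] t \<otimes> y \<in> D} = card {d \<in> D. d \<otimes> (g \<otimes> y) \<in> D}"
    if y: "y \<in> carrier G" for y
  proof -
    have "card {d \<in> D. d [^] t \<otimes> y \<in> D} = card ((\<lambda>d. d [^] t) ` {d \<in> D. d [^] t \<otimes> y \<in> D})"
      by (rule card_image[symmetric], rule inj_on_subset[OF inj]) auto
    also have "(\<lambda>d. d [^] t) ` {d \<in> D. d [^] t \<otimes> y \<in> D} = {x \<in> (\<lambda>d. d [^] t) ` D. x \<otimes> y \<in> D}"
      by auto
    also have "\<dots> = (\<lambda>d. d \<otimes> g) ` {d \<in> D. d \<otimes> (g \<otimes> y) \<in> D}"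
      using D_carrier g y by (auto simp: img im m_assoc)
    also have "card \<dots> = card {d \<in> D. d \<otimes> (g \<otimes> y) \<in> D}"
      by (rule card_image, rule inj_on_subset[OF inj_tr[OF g]]) auto
    finally show ?thesis .
  qed
  \<comment> \<open>For each fixed \<open>d\<close> substitute \<open>x = d \<otimes> h\<close>. The
    left summand is \<open>k\<close> exactly when \<open>g \<otimes> h [^] (t - 1) = \<one>\<close>,
    that is, when \<open>D #> h\<close> is fixed; the right one is \<open>k\<close> exactly when the
    point \<open>x\<close> is fixed. All others are \<open>l\<close>.\<close>
  have count: "(\<Sum>h\<in>carrier G. card {d \<in> D. d [^] t \<otimes> h [^] (t - 1) \<in> D})
      = (\<Sum>x\<in>carrier G. card {d \<in> D. d \<otimes> x [^] (t - 1) \<in> D})"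
  proof -
    have "card {h \<in> carrier G. d [^] t \<otimes> h [^] (t - 1) \<in> D} = card {x \<in> carrier G. d \<otimes> x [^] (t - 1) \<in> D}"
      if "d \<in> D" for d
    proof -
      have d: "d \<in> carrier G" using that D_carrier by auto
      have eq: "d \<otimes> (d \<otimes> h) [^] (t - 1) = d [^] t \<otimes> h [^] (t - 1)" if "h \<in> carrier G" for h
      proof -
        have "d \<otimes> d [^] (t - 1) = d [^] t" using int_pow_mult[OF d, of 1 "t - 1"] d by simp
        then show ?thesis using d that by (simp add: int_pow_distrib m_assoc[symmetric])
      qed
      show ?thesis
        by (rule bij_betw_same_card[of "\<lambda>h. d \<otimes> h"], rule bij_betwI[where g = "\<lambda>x. inv d \<otimes> x"])
          (use d in \<open>auto simp: eq m_assoc[symmetric] simp flip: eq\<close>)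
    qed
    moreover have "(\<Sum>h\<in>carrier G. card {d \<in> D. d [^] t \<otimes> h [^] (t - 1) \<in> D})
        = (\<Sum>d\<in>D. card {h \<in> carrier G. d [^] t \<otimes> h [^] (t - 1) \<in> D})"
      by (rule sum_multicount_gen) (use finite_G finite_D in auto)
    moreover have "(\<Sum>h\<in>carrier G. card {d \<in> D. d \<otimes> h [^] (t - 1) \<in> D})
        = (\<Sum>d\<in>D. card {h \<in> carrier G. d \<otimes> h [^] (t - 1) \<in> D})"
      by (rule sum_multicount_gen) (use finite_G finite_D in auto)
    ultimately show ?thesis by simp
  qed
  \<comment> \<open>Without a fixed translate every left summand is \<open>l\<close>, whereas on the
    right the fixed point \<open>\<one>\<close> contributes \<open>k > l\<close>.\<close>
  have "\<exists>h\<in>carrier G. g \<otimes> h [^] (t - 1) = \<one>"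
  proof (rule ccontr)
    assume no: "\<not> ?thesis"
    have "(\<Sum>h\<in>carrier G. card {d \<in> D. d [^] t \<otimes> h [^] (t - 1) \<in> D}) = (\<Sum>h\<in>carrier G. l)"
      using no g by (intro sum.cong refl) (simp add: block card_shift)
    also have "\<dots> < (\<Sum>x\<in>carrier G. card {d \<in> D. d \<otimes> x [^] (t - 1) \<in> D})"
      by (rule sum_strict_mono_ex1) (use finite_G \<open>l < k\<close> in \<open>auto simp: card_shift intro!: bexI[of _ \<one>]\<close>)
    finally show False using count by simp
  qed
  then obtain h where h: "h \<in> carrier G" "g \<otimes> h [^] (t - 1) = \<one>" by blast
  have "x [^] t \<in> D #> h" if x: "x \<in> D #> h" for x
  proof -
    obtain d where d: "d \<in> D" "x = d \<otimes> h" using x by (auto simp: r_coset_def)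
    then obtain d' where d': "d' \<in> D" "d [^] t = d' \<otimes> g" using img unfolding im by blast
    have c: "d \<in> carrier G" "d' \<in> carrier G" using d d' D_carrier by auto
    have "h [^] t = h [^] (t - 1) \<otimes> h" using int_pow_mult[OF h(1), of "t - 1" 1] h by simp
    then have "x [^] t = d' \<otimes> (g \<otimes> h [^] (t - 1)) \<otimes> h"
      using c h(1) g d d' by (simp add: int_pow_distrib m_assoc)
    then show ?thesis using h c d' by (auto simp: im)
  qed
  then show ?thesis using h by blast
qed

end

section \<open>A difference set fixed by \<open>s\<close>, where
  \<open>x \<mapsto> x [^] (s - 1)\<close> has image of prime order\<close>

locale multiplier_fixed_diff_set = diff_set +
  fixes s :: int and z :: 'a and q :: nat
  assumes prime_q: "Factorial_Ring.prime q"
    and z_carrier: "z \<in> carrier G"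
    and ord_z: "ord z = q"
    and z_fixed: "z [^] (s - 1) = \<one>"
    and z_range: "\<exists>x\<in>carrier G. x [^] (s - 1) = z"
    and range_z: "\<And>x. x \<in> carrier G \<Longrightarrow> \<exists>i::nat. x [^] (s - 1) = z [^] i"
    and fixed: "\<And>x. x \<in> D \<Longrightarrow> x [^] s \<in> D"
begin

lemma z_pow_fixed: "(z [^] (i::nat)) [^] (s - 1) = \<one>"
proof -
  have "(z [^] i) [^] (s - 1) = (z [^] (s - 1)) [^] i"
    using z_carrier by (simp add: int_pow_pow mult.commute flip: int_pow_int)
  then show ?thesis by (simp add: z_fixed)
qed

lemma z_neq_one: "z \<noteq> \<one>"
  using ord_z prime_q z_carrier ord_eq_1 by fastforce

text \<open>Here \<open>x [^] s = x \<otimes> z [^] i\<close> with \<open>i\<close> prime to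
  \<open>q\<close>. Multiplying by powers of \<open>z\<close> does not change the
  \<open>(s - 1)\<close>-th power, so each further \<open>s\<close>-th power multiplies by
  \<open>z [^] i\<close> again, and the iterates fill the coset of the powers of
  \<open>z\<close>.\<close>

lemma shift_pow_closed:
  assumes "x \<in> D" "x [^] (s - 1) \<noteq> \<one>"
  shows "x \<otimes> z [^] (n::nat) \<in> D"
proof -
  have x: "x \<in> carrier G" using assms D_carrier by blast
  then obtain i :: nat where i: "x [^] (s - 1) = z [^] i" using range_z by blast
  have step: "x \<otimes> z [^] (i * j) \<in> D" for j
  proof (induction j)
    case 0
    then show ?case using assms x by simp
  next
    case (Suc j)
    let ?y = "x \<otimes> z [^] (i * j)"
    have y: "?y \<in> carrier G" using x z_carrier by simp
    have "?y [^] (s - 1) = z [^] i"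
      using x z_carrier by (simp add: int_pow_distrib i z_pow_fixed)
    moreover have "?y [^] s = ?y \<otimes> ?y [^] (s - 1)"
      using int_pow_mult[OF y, of 1 "s - 1"] y by simp
    ultimately have "?y [^] s = x \<otimes> z [^] (i * Suc j)"
      using x z_carrier by (simp add: m_assoc nat_pow_mult add.commute)
    then show ?case using fixed[OF Suc] by simp
  qed
  have "\<not> q dvd i"
    using assms(2) i z_carrier ord_z pow_eq_id by metis
  then have "coprime i q" using prime_q by (metis coprime_commute prime_imp_coprime)
  then obtain j where "[i * j = n] (mod q)"
    using cong_solve_coprime_nat[of i q] by (metis cong_scalar_left mult.assoc mult.commute mult_1 One_nat_def)
  then have "z [^] (i * j) = z [^] n"
    using z_carrier ord_z int_pow_eq[OF z_carrier, of "int (i * j)" "int n"]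
    by (metis cong_iff_dvd_diff cong_int_iff cong_sym int_pow_int)
  then show ?thesis using step[of j] by simp
qed

lemma shift_closed_iff:
  assumes x: "x \<in> carrier G" "x [^] (s - 1) \<noteq> \<one>"
  shows "x \<otimes> z \<in> D \<longleftrightarrow> x \<in> D"
proof
  assume "x \<in> D"
  then show "x \<otimes> z \<in> D" using shift_pow_closed[of x 1] x z_carrier by simp
next
  assume xz: "x \<otimes> z \<in> D"
  have "(x \<otimes> z) [^] (s - 1) \<noteq> \<one>"
    using x z_carrier by (simp add: int_pow_distrib z_fixed)
  \<comment> \<open>Another \<open>q - 1\<close> shifts by \<open>z\<close> bring
    \<open>x \<otimes> z\<close> back to \<open>x\<close>.\<close>
  then have *: "x \<otimes> z \<otimes> z [^] (q - 1) \<in> D" by (rule shift_pow_closed[OF xz])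
  have "z \<otimes> z [^] (q - 1) = z [^] q"
    using z_carrier prime_gt_0_nat[OF prime_q] by (metis Suc_diff_1 nat_pow_Suc2)
  also have "\<dots> = \<one>" using ord_z z_carrier pow_ord_eq_1 by blast
  finally show "x \<in> D" using * x z_carrier by (simp add: m_assoc)
qed

text \<open>This is \<open>D - N\<close> of the introductory idea; its cardinality is
  \<open>b\<close>.\<close>

definition moved :: "'a set" where
  "moved = {x \<in> D. x [^] (s - 1) \<noteq> \<one>}"

text \<open>The order of \<open>N\<close>, which is \<open>w\<close> in the parameter
  lemmas.\<close>

definition kernel_card :: nat where
  "kernel_card = card {x \<in> carrier G. x [^] (s - 1) = \<one>}"

lemma range_pow: "(\<lambda>x. x [^] (s - 1)) ` carrier G = (\<lambda>i. z [^] i) ` {0..q - 1}"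
proof
  show "(\<lambda>x. x [^] (s - 1)) ` carrier G \<subseteq> (\<lambda>i. z [^] i) ` {0..q - 1}"
  proof
    fix y assume "y \<in> (\<lambda>x. x [^] (s - 1)) ` carrier G"
    then obtain i :: nat where "y = z [^] i" using range_z by blast
    moreover have "z [^] i = z [^] (i mod q)"
    proof -
      have "i = q * (i div q) + i mod q" by simp
      then have "z [^] i = z [^] (q * (i div q)) \<otimes> z [^] (i mod q)"
        using z_carrier by (metis nat_pow_mult)
      moreover have "z [^] (q * (i div q)) = \<one>"
        using z_carrier ord_z by (simp add: pow_eq_id)
      ultimately show ?thesis using z_carrier by simp
    qed
    ultimately have "y = z [^] (i mod q)" by simp
    moreover have "i mod q \<le> q - 1"
      using prime_gt_0_nat[OF prime_q] by (metis Suc_diff_1 less_Suc_eq_le mod_less_divisor)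
    ultimately show "y \<in> (\<lambda>i. z [^] i) ` {0..q - 1}" by auto
  qed
  obtain g where g: "g \<in> carrier G" "g [^] (s - 1) = z" using z_range by blast
  have "(g [^] i) [^] (s - 1) = (g [^] (s - 1)) [^] i" for i :: nat
    using g(1) by (simp add: int_pow_pow mult.commute flip: int_pow_int)
  then have "z [^] i = (g [^] i) [^] (s - 1)" for i :: nat
    using g(2) by simp
  then show "(\<lambda>i. z [^] i) ` {0..q - 1} \<subseteq> (\<lambda>x. x [^] (s - 1)) ` carrier G"
    using g by auto
qed

lemma card_range_pow: "card ((\<lambda>x. x [^] (s - 1)) ` carrier G) = q"
proof -
  have "inj_on (\<lambda>i. z [^] i) {0..q - 1}"
    using ord_inj[OF z_carrier] ord_z by simp
  then have "card ((\<lambda>i. z [^] i) ` {0..q - 1}) = q"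
    using prime_gt_0_nat[OF prime_q] by (simp add: card_image)
  then show ?thesis by (simp add: range_pow)
qed

text \<open>Each of the \<open>q\<close> nonempty fibres of the power map is a coset of its
  kernel.\<close>

lemma order_eq_kernel: "order G = q * kernel_card"
proof -
  let ?I = "(\<lambda>x. x [^] (s - 1)) ` carrier G"
  have fib: "card {x \<in> carrier G. x [^] (s - 1) = w} = kernel_card" if "w \<in> ?I" for w
  proof -
    obtain g where g: "g \<in> carrier G" "g [^] (s - 1) = w" using \<open>w \<in> ?I\<close> by blast
    have w: "w \<in> carrier G" using g by auto
    show ?thesis unfolding kernel_card_def
      by (rule bij_betw_same_card[of "\<lambda>x. inv g \<otimes> x"], rule bij_betwI[where g = "\<lambda>x. g \<otimes> x"])
        (use g w in \<open>auto simp: int_pow_distrib int_pow_inv m_assoc[symmetric]\<close>)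
  qed
  have "card (carrier G) = (\<Sum>w\<in>?I. card {x \<in> carrier G. x [^] (s - 1) = w})"
    using sum.image_gen[OF finite_G, of "\<lambda>_. 1::nat" "\<lambda>x. x [^] (s - 1)"] by simp
  also have "\<dots> = q * kernel_card" using fib card_range_pow by simp
  finally show ?thesis by (simp add: order_def)
qed

lemma card_moved_le: "card moved \<le> l"
proof -
  have "moved \<subseteq> {x \<in> D. x \<otimes> z \<in> D}"
    using shift_closed_iff D_carrier by (auto simp: moved_def)
  then have "card moved \<le> card {x \<in> D. x \<otimes> z \<in> D}"
    using finite_D by (intro card_mono) auto
  then show ?thesis using shift z_carrier z_neq_one by simp
qed

text \<open>Outside the kernel, a point not in \<open>D\<close> is shifted by \<open>z\<close> to a
  point not in \<open>D\<close>. So the kernel, \<open>moved\<close> and the set counted by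
  \<open>card_shift_complement\<close> cover \<open>G\<close>.\<close>

lemma card_moved_ge: "2 * int k - int l - int kernel_card \<le> int (card moved)"
proof -
  let ?K = "{x \<in> carrier G. x [^] (s - 1) = \<one>}"
  let ?C = "{x \<in> carrier G - D. x \<otimes> z \<notin> D}"
  have "carrier G \<subseteq> ?K \<union> moved \<union> ?C"
    using shift_closed_iff by (auto simp: moved_def)
  then have "order G \<le> card (?K \<union> moved \<union> ?C)"
    unfolding order_def using finite_G finite_D by (intro card_mono) (auto simp: moved_def)
  also have "\<dots> \<le> kernel_card + card moved + card ?C"
    unfolding kernel_card_def
    by (intro order_trans[OF card_Un_le] add_mono order_refl card_Un_le)
  finally have "int (order G) \<le> int kernel_card + int (card moved) + int (card ?C)"
    by linarith
  then show ?thesis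
    using card_shift_complement[OF z_carrier z_neq_one] by linarith
qed

text \<open>Here \<open>n w\<close> is the size of the fibre over \<open>w \<noteq> \<one>\<close> of \<open>x \<mapsto> x\<^bsup>s-1\<^esup>\<close> on \<open>D\<close>; the
  identity counts the pairs in \<open>D\<close> lying in a common fibre in two ways.\<close>

lemma fibre_counts:
  obtains n :: "'a \<Rightarrow> int" and I where "finite I" "card I = q - 1" "(\<Sum>w\<in>I. n w) = int (card moved)"
    "(int k - int (card moved))\<^sup>2 + (\<Sum>w\<in>I. (n w)\<^sup>2) = int k + int l * (int kernel_card - 1)"
proof -
  let ?\<psi> = "\<lambda>x. x [^] (s - 1)"
  let ?K = "{x \<in> carrier G. ?\<psi> x = \<one>}"
  let ?R = "?\<psi> ` carrier G"
  let ?n = "\<lambda>w. card {x \<in> D. ?\<psi> x = w}"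
  have finR: "finite ?R" using finite_G by simp
  have one: "\<one> \<in> ?R" by (rule image_eqI[of _ _ \<one>]) auto
  have one_K: "\<one> \<in> ?K" by simp
  \<comment> \<open>Positivity keeps \<open>kernel_card - 1\<close> from being truncated when the
    identity is carried to the integers.\<close>
  have K: "kernel_card \<ge> 1"
  proof -
    have "finite ?K" using finite_G by simp
    then have "0 < card ?K" using one_K card_gt_0_iff by blast
    then show ?thesis by (simp add: kernel_card_def)
  qed
  have disj: "int k = int (?n \<one>) + int (card moved)"
  proof -
    have "D = {x \<in> D. ?\<psi> x = \<one>} \<union> moved" by (auto simp: moved_def)
    moreover have "card ({x \<in> D. ?\<psi> x = \<one>} \<union> moved) = ?n \<one> + card moved"
      using finite_D by (intro card_Un_disjoint) (auto simp: moved_def)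
    ultimately show ?thesis using card_D by simp
  qed
  have sum_n: "(\<Sum>w\<in>?R - {\<one>}. int (?n w)) = int (card moved)"
  proof -
    have "card moved = (\<Sum>w\<in>?R - {\<one>}. card {x \<in> moved. ?\<psi> x = w})"
    proof -
      have "?\<psi> ` moved \<subseteq> ?R - {\<one>}" using D_carrier by (auto simp: moved_def)
      moreover have "finite moved" using finite_D by (simp add: moved_def)
      ultimately show ?thesis
        using sum.group[of moved "?R - {\<one>}" ?\<psi> "\<lambda>_. 1::nat"] finR by simp
    qed
    also have "\<dots> = (\<Sum>w\<in>?R - {\<one>}. ?n w)"
      by (intro sum.cong refl arg_cong[of _ _ card]) (auto simp: moved_def)
    finally show ?thesis by simp
  qed
  \<comment> \<open>A quotient lies in the kernel exactly when both points lie in the same fibre, so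
    the pair count is a sum of squared fibre sizes.\<close>
  have "(\<Sum>x\<in>D. card {y \<in> D. inv x \<otimes> y \<in> ?K}) = (\<Sum>x\<in>D. ?n (?\<psi> x))"
  proof (intro sum.cong refl arg_cong[of _ _ card])
    fix x assume "x \<in> D"
    then have x: "x \<in> carrier G" by (rule D_carrier)
    have "inv x \<otimes> y \<in> ?K \<longleftrightarrow> ?\<psi> y = ?\<psi> x" if "y \<in> D" for y
    proof -
      have y: "y \<in> carrier G" using that by (rule D_carrier)
      have "?\<psi> (inv x \<otimes> y) = inv (?\<psi> x) \<otimes> ?\<psi> y"
        using x y by (simp add: int_pow_distrib int_pow_inv)
      also have "\<dots> = \<one> \<longleftrightarrow> ?\<psi> y = ?\<psi> x"
        using x y by (metis int_pow_closed inv_closed inv_equality inv_inv l_inv m_comm)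
      finally show ?thesis using x y by simp
    qed
    then show "{y \<in> D. inv x \<otimes> y \<in> ?K} = {y \<in> D. ?\<psi> y = ?\<psi> x}" by blast
  qed
  also have "\<dots> = (\<Sum>w\<in>?R. \<Sum>x\<in>{x \<in> D. ?\<psi> x = w}. ?n (?\<psi> x))"
    using D_carrier finite_D finR by (intro sum.group[symmetric]) auto
  also have "\<dots> = (\<Sum>w\<in>?R. (?n w)\<^sup>2)"
    by (intro sum.cong refl) (simp add: power2_eq_square)
  also have "\<dots> = (?n \<one>)\<^sup>2 + (\<Sum>w\<in>?R - {\<one>}. (?n w)\<^sup>2)"
    using finR one by (simp add: sum.remove)
  finally have "(?n \<one>)\<^sup>2 + (\<Sum>w\<in>?R - {\<one>}. (?n w)\<^sup>2) = k + l * (kernel_card - 1)"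
    using card_quotient_pairs[of ?K] by (auto simp: kernel_card_def)
  from arg_cong[OF this, of int] have "(int (?n \<one>))\<^sup>2 + (\<Sum>w\<in>?R - {\<one>}. (int (?n w))\<^sup>2) = int k + int l * (int kernel_card - 1)"
    using K by (simp add: of_nat_diff)
  moreover have "card (?R - {\<one>}) = q - 1"
    using card_range_pow one finR by simp
  ultimately show thesis
    using that[of "?R - {\<one>}" "\<lambda>w. int (?n w)"] sum_n disj finR by simp
qed

text \<open>With \<open>r = q - 1\<close>, Cauchy-Schwarz over the \<open>q - 1\<close> fibres away
  from the identity supplies \<open>b ^ 2 \<le> r * S\<close>, and \<open>no_odd_parameters\<close>
  excludes \<open>q > 2\<close>.\<close>

lemma hadamard:
  assumes "2 * k < order G" and "int k - int l > 1"
  shows "q = 2 \<and> (\<exists>u::nat. order G = 4 * u\<^sup>2 \<and> k = 2 * u\<^sup>2 - u \<and> l = u\<^sup>2 - u)"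
proof -
  obtain n :: "'a \<Rightarrow> int" and I where I: "finite I" "card I = q - 1" "(\<Sum>w\<in>I. n w) = int (card moved)"
    "(int k - int (card moved))\<^sup>2 + (\<Sum>w\<in>I. (n w)\<^sup>2) = int k + int l * (int kernel_card - 1)"
    by (rule fibre_counts)
  have q2: "q \<ge> 2" using prime_q by (rule prime_ge_2_nat)
  have "order G \<ge> 1" using finite_G order_gt_0_iff_finite by fastforce
  moreover have "k \<ge> 1" using assms by simp
  ultimately have basic: "int k * (int k - 1) = int l * (int q * int kernel_card - 1)"
    using arg_cong[OF basic_equation, of int] order_eq_kernel by (simp add: of_nat_diff)
  have less: "2 * int k < int q * int kernel_card"
    using assms(1) unfolding order_eq_kernel by (metis of_nat_less_iff of_nat_mult of_nat_numeral)
  have b: "int (card moved) \<le> int l" using card_moved_le by simp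
  have two: "q = 2"
  proof (rule ccontr)
    assume "q \<noteq> 2"
    then have "int q - 1 \<ge> 2" using q2 by simp
    moreover have "(int (card moved))\<^sup>2 \<le> (int q - 1) * (\<Sum>w\<in>I. (n w)\<^sup>2)"
      using square_sum_le_card_sum_squares[OF I(1), of n] I q2 by (simp add: of_nat_diff)
    ultimately show False
      using no_odd_parameters[of "int k" "int l" "int q - 1" "int kernel_card" "int (card moved)"]
        basic less b assms(2) I(4) by simp
  qed
  \<comment> \<open>A single fibre remains, so its square sum is exactly
    \<open>b ^ 2\<close>.\<close>
  then have "card I = 1" using I(2) by simp
  then obtain w where "I = {w}" by (rule card_1_singletonE)
  then have sq: "(int k - int (card moved))\<^sup>2 + (int (card moved))\<^sup>2 = int k + int l * (int kernel_card - 1)"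
    using I(3,4) by simp
  obtain u :: int where u: "u > 1" "2 * int kernel_card = 4 * u\<^sup>2" "int k = 2 * u\<^sup>2 - u" "int l = u\<^sup>2 - u"
    using hadamard_parameters[of "int k" "int l" "int kernel_card" "int (card moved)"]
      basic less b assms(2) sq card_moved_ge two by auto
  obtain a :: nat where a: "u = int a" using u(1) nonneg_int_cases[of u] by auto
  have "order G = 4 * a\<^sup>2"
  proof -
    have "int (2 * kernel_card) = int (4 * a\<^sup>2)" using u(2) a by simp
    then have "2 * kernel_card = 4 * a\<^sup>2" by (rule of_nat_eq_iff[THEN iffD1])
    then show ?thesis using order_eq_kernel two by simp
  qed
  moreover have "k = 2 * a\<^sup>2 - a"
  proof -
    have "int (k + a) = int (2 * a\<^sup>2)" using u(3) a by simp
    then have "k + a = 2 * a\<^sup>2" by (rule of_nat_eq_iff[THEN iffD1])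
    then show ?thesis by simp
  qed
  moreover have "l = a\<^sup>2 - a"
  proof -
    have "int (l + a) = int (a\<^sup>2)" using u(4) a by simp
    then have "l + a = a\<^sup>2" by (rule of_nat_eq_iff[THEN iffD1])
    then show ?thesis by simp
  qed
  ultimately show ?thesis using two by blast
qed

end

text \<open>The counting runs on a translate of \<open>D\<close> mapped into itself by the
  \<open>s\<close>-th power map. It yields a statement about the parameters alone, which
  \<open>D\<close> shares.\<close>

lemma hadamard_of_special_multiplier:
  fixes G (structure) and s :: int
  assumes ds: "difference_set G v k l D" and "2 * k < v" and "int k - int l > 1"
    and mult: "multiplier G D s" and q: "Factorial_Ring.prime q"
    and z: "z \<in> carrier G" "group.ord G z = q" "z [^] (s - 1) = \<one>" "\<exists>x\<in>carrier G. x [^] (s - 1) = z"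
    and range: "\<And>x. x \<in> carrier G \<Longrightarrow> \<exists>i::nat. x [^] (s - 1) = z [^] i"
  shows "q = 2 \<and> hadamard_difference_set G D"
proof -
  interpret diff_set G D k l using ds by (rule difference_set_imp_diff_set)
  have v: "order G = v" using ds by (simp add: difference_set_def)
  obtain g where "g \<in> carrier G" "(\<lambda>d. d [^] s) ` D = D #> g"
    using mult by (auto simp: multiplier_def)
  then obtain h where h: "h \<in> carrier G" "\<And>x. x \<in> D #> h \<Longrightarrow> x [^] s \<in> D #> h"
    using exists_fixed_translate[of g s] assms(3) by auto
  interpret E: diff_set G "D #> h" k l using h(1) by (rule translate)
  interpret F: multiplier_fixed_diff_set G "D #> h" k l s z q
    by unfold_locales (use q z range h in auto)
  show ?thesis
    using F.hadamard assms(2,3) ds v unfolding hadamard_difference_set_def by metis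
qed

section \<open>The dichotomy: injective reduction or Hadamard parameters\<close>

theorem theorem7:
  fixes G :: "'a monoid" and H :: "'b monoid" and D :: "'a set" and m v k l :: nat
  assumes "comm_group G" and "finite (carrier G)" and "comm_group H"
    and "G \<cong> integer_mod_group m \<times>\<times> H"
    and "m = group_exponent G"
    and "\<And>p e P. Factorial_Ring.prime p \<Longrightarrow> p dvd m \<Longrightarrow> multiplicity p m = e \<Longrightarrow> e \<ge> 2 \<Longrightarrow>
           sylow_subgroup p H P \<Longrightarrow> group_exponent (H\<lparr>carrier := P\<rparr>) < p ^ e"
    and "difference_set G v k l D" and "2 * k < v" and "int k - int l > 1"
  shows
    "((\<exists>K. subgroup K (unit_group_mod (c_factor m * rad m)) \<and>
         multiplier_group G D \<cong> (unit_group_mod (c_factor m * rad m))\<lparr>carrier := K\<rparr>) \<and>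
      card (carrier (multiplier_group G D)) \<le> c_factor m * totient (rad m))
     \<or>
     (hadamard_difference_set G D \<and>
      (\<exists>e\<ge>2. multiplicity 2 m = e \<and>
        (\<exists>H' :: 'a monoid. comm_group H' \<and> G \<cong> integer_mod_group (2 ^ e) \<times>\<times> H' \<and>
           (\<forall>P. sylow_subgroup 2 H' P \<longrightarrow> group_exponent (H'\<lparr>carrier := P\<rparr>) < 2 ^ e)) \<and>
        (\<forall>H' :: 'a monoid. comm_group H' \<and> G \<cong> integer_mod_group (2 ^ e) \<times>\<times> H' \<and>
           (\<forall>P. sylow_subgroup 2 H' P \<longrightarrow> group_exponent (H'\<lparr>carrier := P\<rparr>) < 2 ^ e) \<longrightarrow>
           (\<exists>t. multiplier G D t \<and>
                [t = 1 + 2 ^ (e - 1)] (mod 2 ^ e) \<and>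
                [t = 1] (mod int (group_exponent H'))))))"
proof -
  interpret G: comm_group G by fact
  interpret H: comm_group H by fact
  note ds = assms(7)
  have D: "D \<subseteq> carrier G" and v: "order G = v" using ds by (auto simp: difference_set_def)
  have m0: "m > 0" using G.group_exponent_pos[OF assms(2)] assms(5) by simp
  have powm: "x [^]\<^bsub>G\<^esub> m = \<one>\<^bsub>G\<^esub>" if "x \<in> carrier G" for x
    using G.pow_group_exponent[OF assms(2) that] assms(5) by simp
  \<comment> \<open>Exponent 1 would make the group trivial, too small for \<open>2 * k < v\<close>
    and \<open>k - l > 1\<close>.\<close>
  have m1: "m > 1"
  proof (rule ccontr)
    assume "\<not> m > 1"
    then have "m = 1" using m0 by simp
    then have "carrier G = {\<one>\<^bsub>G\<^esub>}" using powm by fastforce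
    then have "v = 1" using v by (simp add: order_def)
    then show False using assms(8,9) by simp
  qed
  have m_dvd: "m dvd order G"
    unfolding assms(5) by (rule G.group_exponent_dvd[OF assms(2) G.pow_order_eq_1])
  let ?c = "c_factor m * rad m"
  let ?M = "(\<lambda>t. t mod int m) ` {t. multiplier G D t}"
  have MG: "multiplier_group G D = (unit_group_mod m)\<lparr>carrier := ?M\<rparr>"
    by (simp add: multiplier_group_def flip: assms(5))
  have sub: "subgroup ?M (unit_group_mod m)"
    using subgroup_multipliers[OF assms(1) D m1 m_dvd] .
  have "c_factor m > 0" by (simp add: c_factor_def)
  then have "rad m \<le> ?c" by simp
  then have c1: "?c > 1" using rad_gt_one[OF m1] by linarith
  have c_dvd: "?c dvd m" using m0 by (rule c_factor_rad_dvd)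
  show ?thesis
  \<comment> \<open>Decides whether reduction modulo \<open>?c\<close> has trivial kernel on the
    multiplier group.\<close>
  proof (cases "\<forall>x\<in>?M. x mod int ?c = 1 \<longrightarrow> x = 1")
    case True
    then have triv: "\<And>x. x \<in> ?M \<Longrightarrow> x mod int ?c = 1 \<Longrightarrow> x = 1" by blast
    show ?thesis
      using subgroup_reduction_embedding[OF m1 c1 c_dvd sub triv] MG totient_c_factor_rad[OF m0]
      by simp
  next
    case False
    then obtain t where t: "multiplier G D t" "(t mod int m) mod int ?c = 1" "t mod int m \<noteq> 1"
      by blast
    have "t mod int ?c = 1" using t(2) c_dvd by (metis mod_mod_cancel of_nat_dvd_iff)
    then have tc: "int ?c dvd t - 1" by (metis dvd_minus_mod)
    have tm: "\<not> int m dvd t - 1"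
    proof
      assume "int m dvd t - 1"
      then have "t mod int m = 1 mod int m" by (simp add: mod_eq_dvd_iff)
      then show False using t(3) m1 by simp
    qed
    have "coprime t (int m)"
      using t(1) m_dvd unfolding multiplier_def by (meson coprime_divisors dvd_refl int_dvd_int_iff)
    then obtain q j where q: "Factorial_Ring.prime q" "q\<^sup>2 dvd m"
      and "int m dvd int q * (t ^ j - 1)" "\<not> int m dvd t ^ j - 1"
      using exists_power_of_prime_order[OF m0 _ tc tm] by blast
    then obtain s where s: "multiplier G D s" "int m dvd int q * (s - 1)" "\<not> int m dvd s - 1"
      using multiplier_power[OF assms(1) D t(1)] by blast
    have qm: "q dvd m" using q(2) by (metis dvd_mult_left power2_eq_square)
    have e2: "multiplicity q m \<ge> 2"
      using q m0 by (intro multiplicity_geI) auto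
    obtain \<phi> where \<phi>: "\<phi> \<in> iso G (integer_mod_group m \<times>\<times> H)"
      using assms(4) by (auto simp: is_iso_def)
    interpret cyclic_splitting G H \<phi> m
      by unfold_locales (use assms(2) m0 \<phi> in auto)
    have Hpow: "h [^]\<^bsub>H\<^esub> (m div q) = \<one>\<^bsub>H\<^esub>" if "h \<in> carrier H" for h
      using H.pow_div_prime_eq_one[OF finite_H q(1) m0 qm H_pow_eq_one[OF powm]]
        assms(6)[OF q(1) qm refl e2] that by blast
    obtain z where z: "z \<in> carrier G" "G.ord z = q" "z [^]\<^bsub>G\<^esub> (s - 1) = \<one>\<^bsub>G\<^esub>"
        "\<exists>x\<in>carrier G. x [^]\<^bsub>G\<^esub> (s - 1) = z"
        "\<And>x. x \<in> carrier G \<Longrightarrow> \<exists>i::nat. x [^]\<^bsub>G\<^esub> (s - 1) = z [^]\<^bsub>G\<^esub> i"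
      using cyclic_power_range[OF q s(2,3) Hpow] by blast
    have had: "hadamard_difference_set G D" and q2: "q = 2"
      using hadamard_of_special_multiplier[OF ds assms(8,9) s(1) q(1) z] by auto
    let ?e = "multiplicity 2 m"
    have s_half: "int (m div 2) dvd s - 1"
    proof -
      obtain n where n: "m = 2 * n" using qm q2 by blast
      then have "2 * int n dvd 2 * (s - 1)" using s(2) q2 by simp
      then have "int n dvd s - 1" by (subst (asm) dvd_mult_cancel_left) simp
      then show ?thesis using n by simp
    qed
    \<comment> \<open>The same \<open>s\<close> serves every \<open>H'\<close>: the exponent of
      \<open>H'\<close> divides \<open>m div 2\<close>, which divides \<open>s - 1\<close>.\<close>
    have split: "\<exists>t. multiplier G D t \<and> [t = 1 + 2 ^ (?e - 1)] (mod 2 ^ ?e) \<and>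
        [t = 1] (mod int (group_exponent H'))"
      if H': "comm_group H'" "G \<cong> integer_mod_group (2 ^ ?e) \<times>\<times> H'"
        "\<And>P. sylow_subgroup 2 H' P \<Longrightarrow> group_exponent (H'\<lparr>carrier := P\<rparr>) < 2 ^ ?e"
      for H' :: "'a monoid"
    proof -
      interpret H': comm_group H' by fact
      obtain \<psi> where \<psi>: "\<psi> \<in> iso G (integer_mod_group (2 ^ ?e) \<times>\<times> H')"
        using H'(2) by (auto simp: is_iso_def)
      \<comment> \<open>The coordinates are reused with modulus \<open>2 ^ ?e\<close>, to see that
        \<open>H'\<close> is finite and annihilated by \<open>m\<close>.\<close>
      interpret S': cyclic_splitting G H' \<psi> "2 ^ ?e"
        by unfold_locales (use assms(2) \<psi> in auto)
      have "h [^]\<^bsub>H'\<^esub> (m div 2) = \<one>\<^bsub>H'\<^esub>" if "h \<in> carrier H'" for h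
        using H'.pow_div_prime_eq_one[OF S'.finite_H two_is_prime_nat m0 _ S'.H_pow_eq_one[OF powm] H'(3) that]
          qm q2 by blast
      then have "group_exponent H' dvd m div 2"
        by (rule H'.group_exponent_dvd[OF S'.finite_H])
      then have "int (group_exponent H') dvd s - 1" using s_half by (meson dvd_trans int_dvd_int_iff)
      moreover have "[s = 1 + 2 ^ (?e - 1)] (mod 2 ^ ?e)"
        using cong_one_plus_half_power[OF m0, of s] qm s(2,3) q2 by simp
      ultimately show ?thesis using s(1) by (auto simp: cong_iff_dvd_diff)
    qed
    \<comment> \<open>A splitting of the required kind exists, so the claim about all of them is not
      vacuous.\<close>
    have "\<exists>H' :: 'a monoid. comm_group H' \<and> G \<cong> integer_mod_group (2 ^ ?e) \<times>\<times> H' \<and>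
        (\<forall>P. sylow_subgroup 2 H' P \<longrightarrow> group_exponent (H'\<lparr>carrier := P\<rparr>) < 2 ^ ?e)"
      using exists_primary_splitting[OF q(1) qm Hpow] q2 by simp
    then show ?thesis using had e2 q2 split by blast
  qed
qed

end
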